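(* Let $n\ge 1$ and let $p(z)=z^n+\sum_{k=0}^{n-1}p_kz^k\in\mathbb H[z]$ be a monic polynomial all of whose (left and right) zeros lie in $\mathbb B_1$. Let $A\in\mathbb H^{n\times n}$ and ${\bf v}\in\mathbb H^{n\times 1}$ be such that the pair $(A,{\bf v})$ is similar to $(C_p,{\bf e}_1)$, i.e. $A=TC_pT^{-1}$ and ${\bf v}=T{\bf e}_1$ for some invertible $T\in\mathbb H^{n\times n}$ (so that $\mathfrak C_{A,{\bf v}}$ is invertible, $p(z)=z^n-\begin{bmatrix}1&z&\cdots&z^{n-1}\end{bmatrix}\mathfrak C_{A,{\bf v}}^{-1}A^n{\bf v}$, and $\sigma_{\bf r}(A)\subset\mathbb B_1$). Let $$P_{A,{\bf v}}=\sum_{k=0}^\infty A^k{\bf v}{\bf v}^*A^{*k},\qquad {\bf g}_{A,{\bf v}}=(I-A^* )P_{A,{\bf v}}^{-1}(I-A)^{-1}{\bf v}.$$ Then: (1) The power series $$R(z)={\bf e}_n^*\mathfrak C_{A,{\bf v}}^{-1}P_{A,{\bf v}}(I-zA^* )^{-1}{\bf g}_{A,{\bf v}}=\sum_{k=0}^\infty z^k\,{\bf e}_n^*\mathfrak C_{A,{\bf v}}^{-1}P_{A,{\bf v}}A^{*k}{\bf g}_{A,{\bf v}}$$ has no (left or right) zeros in $\mathbb B_1$ and belongs to $H^2(\mathbb B_1)$, with $$\|R\|^2_{H^2(\mathbb B_1)}={\bf e}_n^*\mathfrak C_{A,{\bf v}}^{-1}P_{A,{\bf v}}(\mathfrak C_{A,{\bf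 v}}^{-1})^{*}{\bf e}_n.$$ (2) The power series $\Theta(z)=p(z)R(z)$ is a finite Blaschke product. Furthermore, $\Theta$ is given explicitly by $$\Theta(z)=1-{\bf v}^*(I-A^* )^{-1}{\bf g}_{A,{\bf v}}+z{\bf v}^*(I-zA^* )^{-1}{\bf g}_{A,{\bf v}}=1-{\bf v}^*(I-A^* )^{-1}{\bf g}_{A,{\bf v}}+\sum_{k=0}^\infty z^{k+1}{\bf v}^*A^{*k}{\bf g}_{A,{\bf v}}.$$
   Context: $\mathbb H$ is the skew field of real quaternions with conjugation $\alpha\mapsto\overline\alpha$ and modulus $|\cdot|$; $\mathbb B_1=\{\alpha\in\mathbb H:|\alpha|<1\}$. $\mathbb H[[z]]$ (resp. $\mathbb H[z]$) is the ring of formal power series (resp. polynomials) in a variable $z$ commuting with the quaternionic coefficients, with the usual Cauchy product $(fg)_k=\sum_{\ell=0}^k f_\ell g_{k-\ell}$. For $f=\sum_k f_kz^k$ with $\limsup_k|f_k|^{1/k}\le 1$ and $\gamma\in\mathbb B_1$, the left and right values are $f^{\boldsymbol{e_\ell}}(\gamma)=\sum_k\gamma^kf_k$ and $f^{\boldsymbol{e_r}}(\gamma)=\sum_kf_k\gamma^k$ (for polynomials these are defined at every $\gamma\in\mathbb H$); $\gamma$ is a left (right) zero of $f$ if $f^{\boldsymbol{e_\ell}}(\gamma)=0$ (resp. $f^{\boldsymbol{e_r}}(\gamma)=0$). $H^2(\mathbb B_1)$ is the set of $f=\sum_kf_kz^k\in\mathbb H[[z]]$ with $\|f\|^2_{H^2(\mathbb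 B_1)}=\sum_k|f_k|^2<\infty$. For $\alpha\in\mathbb B_1$, the Blaschke factor is ${\bf b}_\alpha(z)=(z-\alpha)\sum_{k\ge0}\overline\alpha^kz^k=-\alpha+(1-|\alpha|^2)\sum_{k\ge 0}\overline\alpha^kz^{k+1}$. A finite Blaschke product of degree $n$ is a power series of the form ${\bf b}_{\alpha_1}{\bf b}_{\alpha_2}\cdots{\bf b}_{\alpha_n}\phi$ with $\alpha_1,\dots,\alpha_n\in\mathbb B_1$ and $\phi\in\mathbb H$, $|\phi|=1$ (unimodular constants have degree $0$). ${}^*$ denotes the conjugate transpose of a quaternionic matrix, and ${\bf e}_k$ is the $k$-th column of the identity matrix $I=I_n$. $\sigma_{\bf r}(A)$ is the set of right eigenvalues of $A$: those $\alpha\in\mathbb H$ with $A{\bf x}={\bf x}\alpha$ for some nonzero ${\bf x}\in\mathbb H^{n\times1}$. The companion matrix $C_p\in\mathbb H^{n\times n}$ of $p$ has columns ${\bf e}_2,{\bf e}_3,\dots,{\bf e}_n$ and last column $(-p_0,-p_1,\dots,-p_{n-1})^{\top}$. The controllability matrix of $(A,{\bf v})$ is $\mathfrak C_{A,{\bf v}}=\begin{bmatrix}{\bf v}&A{\bf v}&\cdots&A^{n-1}{\bf v}\end{bmatrix}$. When $\sigma_{\bf r}(A)\subset\mathbb B_1$ and $\mathfrak C_{A,{\bf v}}$ is invertible, the series for $P_{A,{\bf v}}$ converges and $P_{A,{\bf v}}$ is positive definite. *)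

theory Defs
  imports "HOL-Analysis.Analysis" "HOL-Computational_Algebra.Computational_Algebra"
begin

section \<open>Real quaternions\<close>

codatatype quat = Quat (Qr: real) (Qi: real) (Qj: real) (Qk: real)

lemma quat_eq_iff:
  "x = y \<longleftrightarrow> Qr x = Qr y \<and> Qi x = Qi y \<and> Qj x = Qj y \<and> Qk x = Qk y"
  by (auto intro: quat.expand)

instantiation quat :: ab_group_add
begin

primcorec zero_quat where
  "Qr 0 = 0" | "Qi 0 = 0" | "Qj 0 = 0" | "Qk 0 = 0"

primcorec plus_quat where
  "Qr (x + y) = Qr x + Qr y"
| "Qi (x + y) = Qi x + Qi y"
| "Qj (x + y) = Qj x + Qj y"
| "Qk (x + y) = Qk x + Qk y"

primcorec uminus_quat where
  "Qr (- x) = - Qr x"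
| "Qi (- x) = - Qi x"
| "Qj (- x) = - Qj x"
| "Qk (- x) = - Qk x"

primcorec minus_quat where
  "Qr (x - y) = Qr x - Qr y"
| "Qi (x - y) = Qi x - Qi y"
| "Qj (x - y) = Qj x - Qj y"
| "Qk (x - y) = Qk x - Qk y"

instance
  by standard (simp_all add: quat_eq_iff)

end

instantiation quat :: ring_1
begin

primcorec one_quat where
  "Qr 1 = 1" | "Qi 1 = 0" | "Qj 1 = 0" | "Qk 1 = 0"

primcorec times_quat where
  "Qr (x * y) = Qr x * Qr y - Qi x * Qi y - Qj x * Qj y - Qk x * Qk y"
| "Qi (x * y) = Qr x * Qi y + Qi x * Qr y + Qj x * Qk y - Qk x * Qj y"
| "Qj (x * y) = Qr x * Qj y - Qi x * Qk y + Qj x * Qr y + Qk x * Qi y"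
| "Qk (x * y) = Qr x * Qk y + Qi x * Qj y - Qj x * Qi y + Qk x * Qr y"

instance
  by standard (simp_all add: quat_eq_iff algebra_simps)

end

primcorec qcnj :: "quat \<Rightarrow> quat" where
  "Qr (qcnj x) = Qr x"
| "Qi (qcnj x) = - Qi x"
| "Qj (qcnj x) = - Qj x"
| "Qk (qcnj x) = - Qk x"

instantiation quat :: real_algebra_1
begin

primcorec scaleR_quat where
  "Qr (scaleR r x) = r * Qr x"
| "Qi (scaleR r x) = r * Qi x"
| "Qj (scaleR r x) = r * Qj x"
| "Qk (scaleR r x) = r * Qk x"

instance
  by standard (simp_all add: quat_eq_iff algebra_simps)

end

definition quat_sqnorm :: "quat \<Rightarrow> real" where
  "quat_sqnorm x = (Qr x)\<^sup>2 + (Qi x)\<^sup>2 + (Qj x)\<^sup>2 + (Qk x)\<^sup>2"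

lemma quat_sqnorm_nonneg: "0 \<le> quat_sqnorm x"
  by (simp add: quat_sqnorm_def)

lemma quat_sqnorm_eq_0_iff: "quat_sqnorm x = 0 \<longleftrightarrow> x = 0"
proof -
  have "quat_sqnorm x = 0 \<longleftrightarrow> (Qr x)\<^sup>2 = 0 \<and> (Qi x)\<^sup>2 = 0 \<and> (Qj x)\<^sup>2 = 0 \<and> (Qk x)\<^sup>2 = 0"
    unfolding quat_sqnorm_def by (simp only: add_nonneg_eq_0_iff add_nonneg_nonneg zero_le_power2 conj_assoc)
  then show ?thesis
    by (simp add: quat_eq_iff)
qed

lemma quat_sqnorm_mult: "quat_sqnorm (x * y) = quat_sqnorm x * quat_sqnorm y"
  unfolding quat_sqnorm_def by (simp add: power2_eq_square algebra_simps)

lemma mult_qcnj: "x * qcnj x = of_real (quat_sqnorm x)"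
  by (simp add: quat_eq_iff of_real_def quat_sqnorm_def power2_eq_square algebra_simps)

lemma qcnj_mult_self: "qcnj x * x = of_real (quat_sqnorm x)"
  by (simp add: quat_eq_iff of_real_def quat_sqnorm_def power2_eq_square algebra_simps)

instantiation quat :: real_div_algebra
begin

definition "inverse x = qcnj x /\<^sub>R quat_sqnorm x" for x :: quat

definition "x div y = x * inverse y" for x y :: quat

instance
proof
  fix x y :: quat
  show "inverse x * x = 1" if "x \<noteq> 0"
    using that by (simp add: inverse_quat_def qcnj_mult_self quat_sqnorm_eq_0_iff of_real_def)
  show "x * inverse x = 1" if "x \<noteq> 0"
    using that by (simp add: inverse_quat_def mult_qcnj quat_sqnorm_eq_0_iff of_real_def)
  show "x div y = x * inverse y"
    by (rule divide_quat_def)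
  show "inverse (0 :: quat) = 0"
    by (simp add: inverse_quat_def quat_eq_iff)
qed

end

instantiation quat :: real_normed_div_algebra
begin

definition "norm x = sqrt ((Qr x)\<^sup>2 + (Qi x)\<^sup>2 + (Qj x)\<^sup>2 + (Qk x)\<^sup>2)" for x :: quat

definition "sgn x = x /\<^sub>R norm x" for x :: quat

definition "dist x y = norm (x - y)" for x y :: quat

definition uniformity_quat_def:
  "(uniformity :: (quat \<times> quat) filter) = (INF e\<in>{0 <..}. principal {(x :: quat, y). dist x y < e})"

definition open_quat_def:
  "open U \<longleftrightarrow> (\<forall>x\<in>U. eventually (\<lambda>(x', y). x' = x \<longrightarrow> y \<in> U) uniformity)" for U :: "quat set"

instance
proof
  have norm_sq: "norm x = sqrt (quat_sqnorm x)" for x :: quat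
    by (simp add: norm_quat_def quat_sqnorm_def)
  fix r :: real and x y :: quat and U :: "quat set"
  show "dist x y = norm (x - y)"
    by (rule dist_quat_def)
  show "sgn x = x /\<^sub>R norm x"
    by (rule sgn_quat_def)
  show "uniformity = (INF e\<in>{0 <..}. principal {(x :: quat, y). dist x y < e})"
    by (rule uniformity_quat_def)
  show "open U \<longleftrightarrow> (\<forall>x\<in>U. eventually (\<lambda>(x', y). x' = x \<longrightarrow> y \<in> U) uniformity)"
    by (rule open_quat_def)
  show "norm x = 0 \<longleftrightarrow> x = 0"
    by (simp add: norm_sq quat_sqnorm_eq_0_iff)
  show "norm (x * y) = norm x * norm y"
    by (simp add: norm_sq quat_sqnorm_mult real_sqrt_mult)
  have "quat_sqnorm (r *\<^sub>R x) = r\<^sup>2 * quat_sqnorm x"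
    by (simp add: quat_sqnorm_def power_mult_distrib distrib_left)
  then show "norm (r *\<^sub>R x) = \<bar>r\<bar> * norm x"
    by (simp add: norm_sq real_sqrt_mult)
  have norm2: "norm z = norm (norm (Qr z, Qi z), norm (Qj z, Qk z))" for z :: quat
    by (simp add: norm_quat_def norm_Pair)
  have "norm (x + y) =
      norm (norm ((Qr x, Qi x) + (Qr y, Qi y)), norm ((Qj x, Qk x) + (Qj y, Qk y)))"
    by (simp add: norm2)
  also have "\<dots> \<le> norm (norm (Qr x, Qi x) + norm (Qr y, Qi y), norm (Qj x, Qk x) + norm (Qj y, Qk y))"
    unfolding norm_Pair
    by (intro real_sqrt_le_mono add_mono power_mono)
      (auto simp: norm_Pair real_sqrt_sum_squares_triangle_ineq)
  also have "\<dots> \<le> norm x + norm y"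
    using norm_triangle_ineq[of "(norm (Qr x, Qi x), norm (Qj x, Qk x))"
        "(norm (Qr y, Qi y), norm (Qj y, Qk y))"]
    by (simp add: norm2)
  finally show "norm (x + y) \<le> norm x + norm y" .
qed

end

lemma quat_units:
  "Quat 0 1 0 0 * Quat 0 1 0 0 = - 1" "Quat 0 0 1 0 * Quat 0 0 1 0 = - 1"
  "Quat 0 0 0 1 * Quat 0 0 0 1 = - 1" "Quat 0 1 0 0 * Quat 0 0 1 0 = Quat 0 0 0 1"
  by (simp_all add: quat_eq_iff)

abbreviation quat_ball :: "quat set" (\<open>\<bbbB>\<^sub>1\<close>) where
  "\<bbbB>\<^sub>1 \<equiv> {\<alpha>. norm \<alpha> < 1}"


section \<open>Power series over the quaternions\<close>

text \<open>
  The library product of type \<^typ>\<open>quat fps\<close> is the Cauchy product with coefficients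
  multiplied in the given order, so \<^term>\<open>fps_X\<close> is central.  Polynomials are elements of
  \<^typ>\<open>quat poly\<close>; as the library only multiplies polynomials over commutative
  coefficients, they are embedded by \<^const>\<open>fps_of_poly\<close>.  Left and right values are only
  meaningful where the series converges: in the open unit ball for series in \<open>H2\<close>,
  everywhere for polynomials.
\<close>

definition left_value :: "quat fps \<Rightarrow> quat \<Rightarrow> quat" where
  "left_value f \<gamma> = (\<Sum>k. \<gamma> ^ k * fps_nth f k)"

definition right_value :: "quat fps \<Rightarrow> quat \<Rightarrow> quat" where
  "right_value f \<gamma> = (\<Sum>k. fps_nth f k * \<gamma> ^ k)"

definition left_zero :: "quat fps \<Rightarrow> quat \<Rightarrow> bool" where
  "left_zero f \<gamma> \<longleftrightarrow> left_value f \<gamma> = 0"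

definition right_zero :: "quat fps \<Rightarrow> quat \<Rightarrow> bool" where
  "right_zero f \<gamma> \<longleftrightarrow> right_value f \<gamma> = 0"

definition H2 :: "quat fps set" where
  "H2 = {f. summable (\<lambda>k. (norm (fps_nth f k))\<^sup>2)}"

definition H2_norm :: "quat fps \<Rightarrow> real" where
  "H2_norm f = sqrt (\<Sum>k. (norm (fps_nth f k))\<^sup>2)"

definition blaschke_factor :: "quat \<Rightarrow> quat fps" where
  "blaschke_factor \<alpha> = (fps_X - fps_const \<alpha>) * Abs_fps (\<lambda>k. qcnj \<alpha> ^ k)"

definition blaschke_product :: "nat \<Rightarrow> quat fps \<Rightarrow> bool" where
  "blaschke_product d f \<longleftrightarrow>
    (\<exists>\<alpha>s \<phi>. length \<alpha>s = d \<and> set \<alpha>s \<subseteq> \<bbbB>\<^sub>1 \<and> norm \<phi> = 1 \<and>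
      f = prod_list (map blaschke_factor \<alpha>s) * fps_const \<phi>)"


section \<open>Quaternionic matrices\<close>

text \<open>
  Columns in $\mathbb{H}^{n \times 1}$ are matrices of type \<^typ>\<open>quat^1^'n\<close>, so that every
  product below is \<^term>\<open>(**)\<close>, and a $1 \times 1$ matrix is identified with its
  entry.  The index type stands for $\{1,\dots,n\}$, \<open>n = CARD('n)\<close>, where \<open>idx i\<close> is
  the number in $\{1,\dots,n\}$ of the index \<open>i\<close>.
\<close>

definition idx :: "'n::{finite,linorder} \<Rightarrow> nat" where
  "idx i = card {j. j \<le> i}"

abbreviation entry :: "'a^1^1 \<Rightarrow> 'a" where
  "entry M \<equiv> M $ 1 $ 1"

definition e_col :: "nat \<Rightarrow> quat^1^'n::{finite,linorder}" where
  "e_col k = (\<chi> i _. if idx i = k then 1 else 0)"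

definition adj :: "quat^'m^'n \<Rightarrow> quat^'n^'m" where
  "adj M = (\<chi> i j. qcnj (M $ j $ i))"

text \<open>The power \<open>A ^ k\<close> of the type class \<^class>\<open>power\<close> is entrywise on this type.\<close>

primrec mat_power :: "quat^'n^'n \<Rightarrow> nat \<Rightarrow> quat^'n^'n" where
  "mat_power A 0 = mat 1"
| "mat_power A (Suc k) = A ** mat_power A k"

definition right_spectrum :: "quat^'n^'n \<Rightarrow> quat set" where
  "right_spectrum A = {\<alpha>. \<exists>x :: quat^1^'n. x \<noteq> 0 \<and> A ** x = x ** mat \<alpha>}"

definition companion :: "quat poly \<Rightarrow> quat^'n::{finite,linorder}^'n::{finite,linorder}" where
  "companion p = (\<chi> i j. if idx j < CARD('n) then e_col (idx j + 1) $ i $ 1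
                          else - coeff p (idx i - 1))"

definition controllability ::
  "quat^'n::{finite,linorder}^'n::{finite,linorder} \<Rightarrow> quat^1^'n::{finite,linorder}
    \<Rightarrow> quat^'n::{finite,linorder}^'n::{finite,linorder}" where
  "controllability A v = (\<chi> i j. (mat_power A (idx j - 1) ** v) $ i $ 1)"

definition gramian_term :: "quat^'n^'n \<Rightarrow> quat^1^'n \<Rightarrow> nat \<Rightarrow> quat^'n^'n" where
  "gramian_term A v k = mat_power A k ** v ** adj v ** mat_power (adj A) k"

definition gramian :: "quat^'n^'n \<Rightarrow> quat^1^'n \<Rightarrow> quat^'n^'n" where
  "gramian A v = (\<Sum>k. gramian_term A v k)"

definition g_col :: "quat^'n^'n \<Rightarrow> quat^1^'n \<Rightarrow> quat^1^'n" where
  "g_col A v = (mat 1 - adj A) ** matrix_inv (gramian A v) ** matrix_inv (mat 1 - A) ** v"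

text \<open>Constant matrices over \<^typ>\<open>quat fps\<close>, and the resolvent $(I - zM)^{-1}$ as an inverse
  of matrices over that ring.\<close>

abbreviation const_mat :: "quat^'m^'n \<Rightarrow> quat fps^'m^'n" where
  "const_mat \<equiv> map_matrix fps_const"

definition resolvent :: "quat^'n^'n \<Rightarrow> quat fps^'n^'n" where
  "resolvent M = matrix_inv (mat 1 - mat fps_X ** const_mat M)"

definition R_series :: "quat^'n::{finite,linorder}^'n::{finite,linorder} \<Rightarrow> quat^1^'n::{finite,linorder} \<Rightarrow> quat fps" where
  "R_series A v = entry
    (const_mat (adj (e_col CARD('n)) ** matrix_inv (controllability A v) ** gramian A v)
      ** resolvent (adj A) ** const_mat (g_col A v :: quat^1^'n::{finite,linorder}))"

end

theory Submission
  imports Defs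
begin

text \<open>
  With \<open>Z(z) = (1, z, \<dots>, z\<^sup>n\<^sup>-\<^sup>1)\<close> one has \<open>p(z) e\<^sub>n\<^sup>* = Z(z) (z I - C\<^sub>p)\<close>, and the Stein equation
  \<open>P = A P A\<^sup>* + v v\<^sup>*\<close> turns \<open>p R\<close> into the explicit formula for \<open>\<Theta>\<close>. The vector \<open>g\<close> satisfies the
  dual equation \<open>P\<^sup>-\<^sup>1 = A\<^sup>* P\<^sup>-\<^sup>1 A + g g\<^sup>*\<close>, so the squared norm of \<open>R\<close> is a telescoping sum.

  On the other hand \<open>p\<close> is a product of factors \<open>z - \<alpha>\<close> with \<open>\<alpha>\<close> in the ball, and moving the factors
  \<open>1 - \<alpha>\<^sup>* z\<close> to the right gives \<open>p = B s\<close> with a Blaschke product \<open>B\<close> and a polynomial \<open>s\<close> that is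
  invertible among the absolutely summable series. Since \<open>\<Sum> A\<^sup>k v p\<^sub>k = 0\<close>, the series
  \<open>\<Theta> = B (s R)\<close> is orthogonal to \<open>z p h\<close> for all \<open>h\<close>, hence to all \<open>B z\<^sup>m\<^sup>+\<^sup>1\<close>. Multiplication by
  \<open>B\<close> is isometric, so \<open>s R\<close> is a constant, of modulus 1 because \<open>\<Theta>\<close> has value 1 at \<open>z = 1\<close>.
\<close>


text \<open>Over the quaternions left and right values are not multiplicative, so neither a
  factorization of p nor the absence of zeros of R follows by substitution. What survives is weaker:
  for a polynomial on a class of fixed real part and modulus, left and right evaluation are affine
  with the same two coefficients, so a zero on one side yields a zero of equal modulus on the other.
  The rearrangements of factors therefore control moduli only, which is enough to stay inside the
  ball. Evaluation at the central point 1 is multiplicative, and the choice of g makes the series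
  for Theta telescope there. No spectral theory enters: the columns A^k v satisfy the linear
  recursion with the coefficients of p, and peeling off its factors one by one gives absolute
  summability of the powers of A. The spectral inclusion is then a consequence. Hence R is
  absolutely summable too, so products, inner product and value at 1 are all available in one space.
  Passing from z p h to B z^(m+1) means choosing h = s^(-1) z^m, which is why s is inverted among
  the summable series and not just formally.\<close>

section \<open>Quaternions as a Euclidean space\<close>

text \<open>Finite dimension over the reals gives completeness, continuity of real-linear maps
  between matrix spaces, and surjectivity of the injective ones.\<close>

instantiation quat :: euclidean_space
begin

definition inner_quat :: "quat \<Rightarrow> quat \<Rightarrow> real" where
  "inner_quat x y = Qr x * Qr y + Qi x * Qi y + Qj x * Qj y + Qk x * Qk y"

definition Basis_quat :: "quat set" where
  "Basis_quat = {Quat 1 0 0 0, Quat 0 1 0 0, Quat 0 0 1 0, Quat 0 0 0 1}"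

instance
proof
  fix x y z :: quat and r :: real
  have self: "inner x x = quat_sqnorm x"
    by (simp add: inner_quat_def quat_sqnorm_def power2_eq_square)
  show "inner x y = inner y x"
    by (simp add: inner_quat_def mult.commute)
  show "inner (x + y) z = inner x z + inner y z"
    by (simp add: inner_quat_def algebra_simps)
  show "inner (r *\<^sub>R x) y = r * inner x y"
    by (simp add: inner_quat_def algebra_simps)
  show "0 \<le> inner x x" "inner x x = 0 \<longleftrightarrow> x = 0"
    by (simp_all add: self quat_sqnorm_nonneg quat_sqnorm_eq_0_iff)
  show "norm x = sqrt (inner x x)"
    by (simp add: self norm_quat_def quat_sqnorm_def)
  show "(Basis :: quat set) \<noteq> {}" "finite (Basis :: quat set)"
    by (simp_all add: Basis_quat_def)
  show "inner u w = (if u = w then 1 else 0)" if "u \<in> Basis" "w \<in> Basis" for u w :: quat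
    using that unfolding Basis_quat_def inner_quat_def
    by (elim insertE emptyE; simp)
  show "(\<forall>u\<in>Basis. inner x u = 0) \<longleftrightarrow> x = 0"
    unfolding Basis_quat_def inner_quat_def quat_eq_iff[of x] by simp
qed

end

lemma qcnj_qcnj [simp]: "qcnj (qcnj x) = x"
  by (simp add: quat_eq_iff)

lemma qcnj_add [simp]: "qcnj (x + y) = qcnj x + qcnj y"
  by (simp add: quat_eq_iff)

lemma qcnj_diff [simp]: "qcnj (x - y) = qcnj x - qcnj y"
  by (simp add: quat_eq_iff)

lemma qcnj_mult: "qcnj (x * y) = qcnj y * qcnj x"
  by (simp add: quat_eq_iff)

lemma qcnj_0 [simp]: "qcnj 0 = 0"
  by (simp add: quat_eq_iff)

lemma qcnj_1 [simp]: "qcnj 1 = 1"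
  by (simp add: quat_eq_iff)

lemma norm_qcnj [simp]: "norm (qcnj x) = norm x"
  by (simp add: norm_quat_def)

lemma qcnj_scaleR [simp]: "qcnj (r *\<^sub>R x) = r *\<^sub>R qcnj x"
  by (simp add: quat_eq_iff)

lemma qcnj_sum: "qcnj (sum f S) = (\<Sum>i\<in>S. qcnj (f i))"
  by (induction S rule: infinite_finite_induct) simp_all

lemma qcnj_power: "qcnj (x ^ k) = qcnj x ^ k"
  by (induction k) (simp_all add: qcnj_mult power_commutes)

lemma bounded_linear_qcnj: "bounded_linear qcnj"
  by (rule bounded_linear_intro[where K = 1]) simp_all

lemma quat_sqnorm_norm: "quat_sqnorm x = (norm x)\<^sup>2"
  by (simp add: norm_quat_def quat_sqnorm_def)

lemma mult_qcnj_norm: "x * qcnj x = of_real ((norm x)\<^sup>2)"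
  and qcnj_mult_norm: "qcnj x * x = of_real ((norm x)\<^sup>2)"
  by (simp_all add: mult_qcnj qcnj_mult_self quat_sqnorm_norm)


section \<open>Quaternionic matrices\<close>

lemma matrix_sub_ldistrib: "A ** (B - C) = A ** B - A ** C" for A :: "'a::ring_1^'n^'m"
  by (vector matrix_matrix_mult_def sum_subtractf right_diff_distrib)

lemma matrix_sub_rdistrib: "(A - B) ** C = A ** C - B ** C" for A :: "'a::ring_1^'n^'m"
  by (vector matrix_matrix_mult_def sum_subtractf left_diff_distrib)

lemma matrix_add_rdistrib: "(A + B) ** C = A ** C + B ** C"
  by (vector matrix_matrix_mult_def sum.distrib distrib_right)

lemma matrix_mult_0 [simp]: "A ** 0 = 0" "0 ** A = 0" for A :: "'a::ring_1^'n^'m"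
  by (vector matrix_matrix_mult_def)+

lemma matrix_inv:
  fixes A :: "'a::semiring_1^'n^'n"
  assumes "invertible A"
  shows "A ** matrix_inv A = mat 1" "matrix_inv A ** A = mat 1"
  using someI_ex[OF assms[unfolded invertible_def]] by (simp_all add: matrix_inv_def)

lemma matrix_inv_eqI:
  fixes A B :: "'a::semiring_1^'n^'n"
  assumes "A ** B = mat 1" "B ** A = mat 1"
  shows "matrix_inv A = B"
proof -
  have "invertible A"
    using assms by (auto simp: invertible_def)
  then have "A ** matrix_inv A = mat 1"
    by (rule matrix_inv)
  then show ?thesis
    by (metis assms(2) matrix_mul_assoc matrix_mul_lid matrix_mul_rid)
qed

lemma adj_mult: "adj (A ** B) = adj B ** adj A"
  by (simp add: vec_eq_iff adj_def matrix_matrix_mult_def qcnj_sum qcnj_mult)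

lemma adj_adj [simp]: "adj (adj A) = A"
  by (simp add: vec_eq_iff adj_def)

lemma adj_0 [simp]: "adj 0 = 0"
  by (simp add: vec_eq_iff adj_def)

lemma adj_mat_1 [simp]: "adj (mat 1) = mat 1"
  by (auto simp: vec_eq_iff adj_def mat_def)

lemma adj_diff: "adj (A - B) = adj A - adj B"
  by (simp add: vec_eq_iff adj_def)

lemma adj_add: "adj (A + B) = adj A + adj B"
  by (simp add: vec_eq_iff adj_def)

lemma entry_adj: "entry (adj M) = qcnj (entry M)"
  by (simp add: adj_def)

lemma entry_mult: "entry (M ** N) = entry M * entry N" for M N :: "'a::semiring_1^1^1"
  by (simp add: matrix_matrix_mult_def)

lemma mat_power_commute: "mat_power A k ** A = A ** mat_power A k"
  by (induction k) (simp_all flip: matrix_mul_assoc)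

lemma mat_power_add: "mat_power A (j + k) = mat_power A j ** mat_power A k"
  by (induction j) (simp_all add: matrix_mul_assoc)

lemma adj_mat_power: "adj (mat_power A k) = mat_power (adj A) k"
  by (induction k) (simp_all add: adj_mult mat_power_commute)

lemma invertible_adj: "invertible A \<Longrightarrow> invertible (adj A)"
  unfolding invertible_def by (metis adj_mult adj_mat_1)

lemma adj_matrix_inv:
  fixes A :: "quat^'n^'n"
  assumes "invertible A"
  shows "adj (matrix_inv A) = matrix_inv (adj A)"
  by (rule matrix_inv_eqI[symmetric]) (simp_all only: matrix_inv assms adj_mat_1 adj_mult[symmetric])

text \<open>A matrix over the quaternions acts real-linearly on columns, so the rank theorem over
  the reals applies.\<close>

lemma invertible_if_injective:
  fixes M :: "quat^'n^'n"
  assumes "\<And>x :: quat^1^'n. M ** x = 0 \<Longrightarrow> x = 0"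
  shows "invertible M"
proof -
  let ?f = "\<lambda>x :: quat^1^'n. M ** x"
  have lin: "linear ?f"
    by (rule linearI)
      (simp_all add: matrix_add_ldistrib, simp add: vec_eq_iff matrix_matrix_mult_def scaleR_sum_right)
  then have "inj ?f"
    using assms by (simp add: linear_injective_0)
  then have "surj ?f"
    using lin linear_injective_imp_surjective by blast
  define x where "x j = inv ?f (\<chi> i _. if i = j then 1 else 0)" for j
  have x: "M ** x j = (\<chi> i _. if i = j then 1 else 0)" for j
    unfolding x_def by (rule surj_f_inv_f[OF \<open>surj ?f\<close>])
  define N :: "quat^'n^'n" where "N = (\<chi> i j. x j $ i $ 1)"
  have "(M ** N) $ i $ j = (M ** x j) $ i $ 1" for i j
    by (simp add: N_def matrix_matrix_mult_def)
  then have MN: "M ** N = mat 1"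
    by (simp add: vec_eq_iff x mat_def)
  \<comment> \<open>\<open>M\<close> kills every column of this difference, so injectivity turns the
    right inverse into a left inverse.\<close>
  have "N ** M - mat 1 = 0"
  proof -
    define D where "D = N ** M - mat 1"
    have "M ** D = 0"
      by (simp add: D_def matrix_sub_ldistrib matrix_mul_assoc MN)
    have "(\<chi> i (_::1). D $ i $ j) = 0" for j
    proof (rule assms)
      have "(M ** (\<chi> i (_::1). D $ i $ j)) $ i $ k = (M ** D) $ i $ j" for i k
        by (simp add: matrix_matrix_mult_def)
      then show "M ** (\<chi> i (_::1). D $ i $ j) = 0"
        by (simp add: \<open>M ** D = 0\<close> vec_eq_iff)
    qed
    then show ?thesis
      unfolding D_def[symmetric] by (simp add: vec_eq_iff)
  qed
  then show ?thesis
    unfolding invertible_def using MN by auto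
qed

lemma tendsto_matrix_mult:
  fixes f :: "'b \<Rightarrow> quat^'n^'m" and g :: "'b \<Rightarrow> quat^'p^'n"
  assumes "(f \<longlongrightarrow> a) F" "(g \<longlongrightarrow> b) F"
  shows "((\<lambda>x. f x ** g x) \<longlongrightarrow> a ** b) F"
  unfolding matrix_matrix_mult_def
  by (intro vec_tendstoI) (auto intro!: tendsto_sum tendsto_mult tendsto_vec_nth assms)

lemma tendsto_adj:
  fixes f :: "'b \<Rightarrow> quat^'n^'m"
  assumes "(f \<longlongrightarrow> a) F"
  shows "((\<lambda>x. adj (f x)) \<longlongrightarrow> adj a) F"
  unfolding adj_def
  by (intro vec_tendstoI)
    (auto intro!: bounded_linear.tendsto[OF bounded_linear_qcnj] tendsto_vec_nth assms)

lemma bounded_linear_matrix_mult: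
  fixes M :: "quat^'n^'m" and N :: "quat^'q^'p"
  shows "bounded_linear (\<lambda>X. M ** X ** N)"
proof -
  have "M ** (r *\<^sub>R X) ** N = r *\<^sub>R (M ** X ** N)" for r and X :: "quat^'p^'n"
    by (simp add: vec_eq_iff matrix_matrix_mult_def scaleR_sum_right scaleR_sum_left sum_distrib_right)
  moreover have "M ** (X + Y) ** N = M ** X ** N + M ** Y ** N" for X Y :: "quat^'p^'n"
    by (vector matrix_matrix_mult_def sum.distrib algebra_simps)
  ultimately have "linear (\<lambda>X. M ** X ** N)"
    by (intro linearI)
  then show ?thesis
    by (simp add: linear_conv_bounded_linear)
qed

lemma bounded_linear_entry: "bounded_linear (\<lambda>M :: quat^1^1. entry M)"
  by (intro bounded_linear_compose[OF bounded_linear_vec_nth] bounded_linear_vec_nth)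

lemma summable_vec:
  fixes f :: "nat \<Rightarrow> 'a::real_normed_vector^'n"
  assumes "\<And>i. summable (\<lambda>k. f k $ i)"
  shows "summable f"
proof -
  have "f sums (\<chi> i. \<Sum>k. f k $ i)"
    unfolding sums_def
    by (rule vec_tendstoI) (use summable_LIMSEQ[OF assms] in \<open>simp add: sum_component\<close>)
  then show ?thesis
    by (rule sums_summable)
qed


section \<open>Zeros of quaternionic polynomials\<close>

text \<open>On the class of quaternions with a given real part and modulus, every power is the same
  real combination of \<open>\<gamma>\<close> and 1.\<close>

lemma quat_quadratic: "(x :: quat) * x = (2 * Qr x) *\<^sub>R x - of_real ((norm x)\<^sup>2)"
  by (simp add: quat_eq_iff of_real_def norm_quat_def power2_eq_square algebra_simps)

lemma power_if_quadratic:
  obtains a b :: "nat \<Rightarrow> real"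
  where "\<And>x k. (x :: quat) * x = t *\<^sub>R x - of_real m \<Longrightarrow> x ^ k = a k *\<^sub>R x + of_real (b k)"
proof -
  have "\<exists>a b. \<forall>x :: quat. x * x = t *\<^sub>R x - of_real m \<longrightarrow> x ^ k = a *\<^sub>R x + of_real b" for k
  proof (induction k)
    case 0
    show ?case
      by (rule exI[of _ 0], rule exI[of _ 1]) simp
  next
    case (Suc k)
    then obtain a b where ab: "\<And>x :: quat. x * x = t *\<^sub>R x - of_real m \<Longrightarrow> x ^ k = a *\<^sub>R x + of_real b"
      by blast
    have "x ^ Suc k = (a * t + b) *\<^sub>R x + of_real (- a * m)" if "x * x = t *\<^sub>R x - of_real m" for x :: quat
    proof -
      have "x ^ Suc k = a *\<^sub>R (x * x) + b *\<^sub>R x"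
        by (simp add: ab[OF that] distrib_left) (simp add: of_real_def)
      then show ?thesis
        by (simp add: that of_real_def scaleR_add_left scaleR_diff_right)
    qed
    then show ?case
      by blast
  qed
  then show ?thesis
    using that by metis
qed

text \<open>On the class of \<gamma> the powers are real combinations of x and 1. Real numbers are
  central, so the left value is x A + B and the right value A x + B with the same A and B. If A = 0,
  both vanish at \<gamma> itself; otherwise conjugation by A turns A \<gamma> into \<delta>
  A.\<close>

lemma right_root_imp_left_root:
  fixes c :: "nat \<Rightarrow> quat"
  assumes "(\<Sum>k\<le>n. c k * \<gamma> ^ k) = 0"
  obtains \<delta> where "norm \<delta> = norm \<gamma>" "(\<Sum>k\<le>n. \<delta> ^ k * c k) = 0"
proof -
  obtain a b where ab: "\<And>x k. (x :: quat) * x = (2 * Qr \<gamma>) *\<^sub>R x - of_real ((norm \<gamma>)\<^sup>2) \<Longrightarrow>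
      x ^ k = a k *\<^sub>R x + of_real (b k)"
    using power_if_quadratic[of "2 * Qr \<gamma>" "(norm \<gamma>)\<^sup>2"] by blast
  define A B where "A = (\<Sum>k\<le>n. a k *\<^sub>R c k)" and "B = (\<Sum>k\<le>n. b k *\<^sub>R c k)"
  have left: "(\<Sum>k\<le>n. x ^ k * c k) = x * A + B"
    if "x * x = (2 * Qr \<gamma>) *\<^sub>R x - of_real ((norm \<gamma>)\<^sup>2)" for x
    by (simp add: ab[OF that] A_def B_def sum_distrib_left distrib_right sum.distrib)
       (simp add: of_real_def)
  have "A * \<gamma> + B = 0"
    using assms
    by (simp add: ab[OF quat_quadratic] A_def B_def sum_distrib_right distrib_left sum.distrib)
       (simp add: of_real_def)
  show ?thesis
  proof (cases "A = 0")
    case True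
    then show ?thesis
      using that[of \<gamma>] left[OF quat_quadratic] \<open>A * \<gamma> + B = 0\<close> by simp
  next
    case False
    define \<delta> where "\<delta> = A * \<gamma> * inverse A"
    have "\<delta> * \<delta> = A * (\<gamma> * \<gamma>) * inverse A"
      using False by (simp add: \<delta>_def mult.assoc) (simp add: mult.assoc[symmetric])
    also have "\<dots> = (2 * Qr \<gamma>) *\<^sub>R \<delta> - of_real ((norm \<gamma>)\<^sup>2)"
      using False by (subst quat_quadratic) (simp add: \<delta>_def of_real_def algebra_simps)
    finally have "(\<Sum>k\<le>n. \<delta> ^ k * c k) = \<delta> * A + B"
      by (rule left)
    moreover have "\<delta> * A = A * \<gamma>"
      using False by (simp add: \<delta>_def mult.assoc)
    moreover have "norm \<delta> = norm \<gamma>"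
      using False by (simp add: \<delta>_def norm_mult norm_inverse)
    ultimately show ?thesis
      using that \<open>A * \<gamma> + B = 0\<close> by simp
  qed
qed

lemma left_root_imp_right_root:
  fixes c :: "nat \<Rightarrow> quat"
  assumes "(\<Sum>k\<le>n. \<gamma> ^ k * c k) = 0"
  obtains \<delta> where "norm \<delta> = norm \<gamma>" "(\<Sum>k\<le>n. c k * \<delta> ^ k) = 0"
proof -
  have "(\<Sum>k\<le>n. qcnj (c k) * qcnj \<gamma> ^ k) = qcnj (\<Sum>k\<le>n. \<gamma> ^ k * c k)"
    by (simp add: qcnj_sum qcnj_mult qcnj_power)
  with assms obtain \<delta> where \<delta>: "norm \<delta> = norm (qcnj \<gamma>)" "(\<Sum>k\<le>n. \<delta> ^ k * qcnj (c k)) = 0"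
    using right_root_imp_left_root[of "\<lambda>k. qcnj (c k)" "qcnj \<gamma>" n] by auto
  have "(\<Sum>k\<le>n. c k * qcnj \<delta> ^ k) = qcnj (\<Sum>k\<le>n. \<delta> ^ k * qcnj (c k))"
    by (simp add: qcnj_sum qcnj_mult qcnj_power)
  then show ?thesis
    using that[of "qcnj \<delta>"] \<delta> by simp
qed

section \<open>Existence of a left zero\<close>

definition quat_of_complex :: "complex \<Rightarrow> quat" where
  "quat_of_complex z = Quat (Re z) (Im z) 0 0"

lemma quat_of_complex_simps [simp]:
  "quat_of_complex (x + y) = quat_of_complex x + quat_of_complex y"
  "quat_of_complex (x - y) = quat_of_complex x - quat_of_complex y"
  "quat_of_complex (x * y) = quat_of_complex x * quat_of_complex y"
  "quat_of_complex 0 = 0" "quat_of_complex 1 = 1"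
  by (simp_all add: quat_eq_iff quat_of_complex_def)

lemma quat_of_complex_power: "quat_of_complex (x ^ k) = quat_of_complex x ^ k"
  by (induction k) simp_all

lemma quat_of_complex_sum: "quat_of_complex (sum f S) = (\<Sum>i\<in>S. quat_of_complex (f i))"
  by (induction S rule: infinite_finite_induct) simp_all

text \<open>Writing the coefficients as \<open>x\<^sub>k + y\<^sub>k j\<close> with complex \<open>x\<^sub>k\<close>, \<open>y\<^sub>k\<close>, the
  conjugate \<open>q \<lambda> q\<^sup>-\<^sup>1\<close> of a complex \<open>\<lambda>\<close>, where \<open>q\<^sup>-\<^sup>1 = u + w j\<close>, is a left zero iff \<open>(u, w)\<close> solves
  a homogeneous complex \<open>2 \<times> 2\<close> system, whose determinant is a complex polynomial in \<open>\<lambda>\<close>.\<close>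

lemma exists_left_root:
  fixes c :: "nat \<Rightarrow> quat"
  assumes "n \<ge> 1" "c n = 1"
  obtains \<gamma> where "(\<Sum>k\<le>n. \<gamma> ^ k * c k) = 0"
proof -
  define jj where "jj = Quat 0 0 1 0"
  define x y where "x k = Complex (Qr (c k)) (Qi (c k))" and "y k = Complex (Qj (c k)) (Qk (c k))" for k
  define X X' Y Y' where
    "X = (\<Sum>k\<le>n. monom (x k) k)" and "X' = (\<Sum>k\<le>n. monom (cnj (x k)) k)" and
    "Y = (\<Sum>k<n. monom (y k) k)" and "Y' = (\<Sum>k<n. monom (cnj (y k)) k)"
  have xn: "x n = 1" and yn: "y n = 0"
    by (simp_all add: x_def y_def assms complex_eq_iff)
  have coeff: "coeff X k = (if k \<le> n then x k else 0)" "coeff X' k = (if k \<le> n then cnj (x k) else 0)"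
    "coeff Y k = (if k < n then y k else 0)" "coeff Y' k = (if k < n then cnj (y k) else 0)" for k
    by (simp_all add: X_def X'_def Y_def Y'_def coeff_sum)
  have deg: "degree X = n" "degree X' = n"
    by (auto intro!: antisym degree_le le_degree simp: coeff xn)
  have deg': "degree Y < n" "degree Y' < n"
    using \<open>n \<ge> 1\<close> by (auto intro!: le_less_trans[OF degree_le[of "n - 1"]] simp: coeff)
  \<comment> \<open>The determinant is not constant: \<open>c n = 1\<close> has no j-part, so
    \<open>Y\<close> and \<open>Y'\<close> have degree below n and cannot disturb the top term of
    \<open>X * X'\<close>.\<close>
  have "coeff (X * X' + Y * Y') (2 * n) = 1"
  proof -
    have "coeff (X * X') (2 * n) = 1"
      using coeff_mult_degree_sum[of X X'] by (simp add: deg coeff xn mult_2)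
    moreover have "degree (Y * Y') < 2 * n"
      using degree_mult_le[of Y Y'] deg' by linarith
    ultimately show ?thesis
      by (simp add: coeff_eq_0)
  qed
  then have "degree (X * X' + Y * Y') \<noteq> 0"
    using \<open>n \<ge> 1\<close> le_degree[of "X * X' + Y * Y'" "2 * n"] by auto
  then obtain z where z: "poly (X * X' + Y * Y') z = 0"
    using fundamental_theorem_of_algebra constant_degree by metis
  \<comment> \<open>A kernel vector of the singular system: read off from the first equation, or
    from the second if the first is trivial; any vector serves if both are.\<close>
  obtain u w where uw: "u \<noteq> 0 \<or> w \<noteq> 0"
    "u * poly X z - w * poly Y' z = 0" "u * poly Y z + w * poly X' z = 0"
  proof (cases "poly Y' z = 0 \<and> poly X z = 0")
    case False
    then show ?thesis
      using that[of "poly Y' z" "poly X z"] z by (auto simp: algebra_simps)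
  next
    case True
    then show ?thesis
      using that[of "poly X' z" "- poly Y z"] that[of 1 0] z by (cases "poly X' z = 0 \<and> poly Y z = 0") (auto simp: algebra_simps)
  qed
  have pX: "poly X z = (\<Sum>k\<le>n. z ^ k * x k)" "poly X' z = (\<Sum>k\<le>n. z ^ k * cnj (x k))"
    by (simp_all add: X_def X'_def poly_sum poly_monom mult.commute)
  have "{..n} = insert n {..<n}"
    by auto
  then have pY: "poly Y z = (\<Sum>k\<le>n. z ^ k * y k)" "poly Y' z = (\<Sum>k\<le>n. z ^ k * cnj (y k))"
    by (simp_all add: Y_def Y'_def poly_sum poly_monom mult.commute yn)
  define h where "h = quat_of_complex"
  define r where "r = h u + h w * jj"
  have "r \<noteq> 0"
    using uw(1) by (auto simp: r_def h_def quat_of_complex_def jj_def quat_eq_iff complex_eq_iff)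
  \<comment> \<open>Moving j past a complex number conjugates it, which is where \<open>cnj\<close>
    enters the system.\<close>
  have rc: "r * c k = h (u * x k - w * cnj (y k)) + h (u * y k + w * cnj (x k)) * jj" for k
    by (simp add: r_def h_def quat_of_complex_def jj_def quat_eq_iff x_def y_def)
  define \<gamma> where "\<gamma> = inverse r * h z * r"
  have "\<gamma> ^ k = inverse r * h z ^ k * r" for k
  proof (induction k)
    case (Suc k)
    then have "\<gamma> ^ Suc k = inverse r * h z * (r * inverse r) * h z ^ k * r"
      by (simp add: \<gamma>_def mult.assoc)
    then show ?case
      using \<open>r \<noteq> 0\<close> by (simp add: mult.assoc)
  qed (use \<open>r \<noteq> 0\<close> in simp)
  then have "(\<Sum>k\<le>n. \<gamma> ^ k * c k) = inverse r * (\<Sum>k\<le>n. h z ^ k * (r * c k))"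
    by (simp add: sum_distrib_left mult.assoc)
  also have "(\<Sum>k\<le>n. h z ^ k * (r * c k)) =
      h (\<Sum>k\<le>n. z ^ k * (u * x k - w * cnj (y k))) + h (\<Sum>k\<le>n. z ^ k * (u * y k + w * cnj (x k))) * jj"
    unfolding rc h_def quat_of_complex_sum sum_distrib_right sum.distrib[symmetric] quat_of_complex_simps(3) quat_of_complex_power
    by (simp only: distrib_left mult.assoc)
  also have "(\<Sum>k\<le>n. z ^ k * (u * x k - w * cnj (y k))) = 0"
    using uw(2) unfolding pX pY by (simp add: sum_distrib_left sum_subtractf algebra_simps)
  also have "(\<Sum>k\<le>n. z ^ k * (u * y k + w * cnj (x k))) = 0"
    using uw(3) unfolding pX pY by (simp add: sum_distrib_left sum.distrib algebra_simps)
  finally show ?thesis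
    using that by (simp add: h_def)
qed

section \<open>Factorization into linear factors\<close>

lemma fps_linear_mult_nth:
  fixes f :: "'a::ring_1 fps"
  shows "fps_nth ((fps_const c + fps_const d * fps_X) * f) k =
           c * fps_nth f k + (case k of 0 \<Rightarrow> 0 | Suc j \<Rightarrow> d * fps_nth f j)"
    and "fps_nth (f * (fps_const c + fps_const d * fps_X)) k =
           fps_nth f k * c + (case k of 0 \<Rightarrow> 0 | Suc j \<Rightarrow> fps_nth f j * d)"
proof -
  have "f * (fps_const c + fps_const d * fps_X) = f * fps_const c + fps_X * (f * fps_const d)"
    by (simp only: distrib_left fps_mult_fps_X_commute mult.assoc)
  then show "fps_nth (f * (fps_const c + fps_const d * fps_X)) k =
           fps_nth f k * c + (case k of 0 \<Rightarrow> 0 | Suc j \<Rightarrow> fps_nth f j * d)"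
    by (simp split: nat.split)
  show "fps_nth ((fps_const c + fps_const d * fps_X) * f) k =
           c * fps_nth f k + (case k of 0 \<Rightarrow> 0 | Suc j \<Rightarrow> d * fps_nth f j)"
    by (simp add: distrib_right mult.assoc split: nat.split)
qed

lemma fps_X_minus_eq: "fps_X - fps_const \<alpha> = fps_const (- \<alpha>) + fps_const 1 * (fps_X :: 'a::ring_1 fps)"
  by simp

lemma fps_X_minus_mult_nth:
  fixes f :: "'a::ring_1 fps"
  shows "fps_nth ((fps_X - fps_const \<alpha>) * f) k =
           (case k of 0 \<Rightarrow> 0 | Suc j \<Rightarrow> fps_nth f j) - \<alpha> * fps_nth f k"
  unfolding fps_X_minus_eq fps_linear_mult_nth by (simp split: nat.split)

text \<open>The two sides are played against each other. A left zero \<alpha> splits off a factor on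
  the left, and it lies in the ball because a right zero of equal modulus exists. Right zeros of the
  remaining right factor are right zeros of f, so the hypothesis is inherited.\<close>

lemma monic_factorization:
  fixes f :: "quat fps"
  assumes "\<And>k. k > n \<Longrightarrow> fps_nth f k = 0" "fps_nth f n = 1"
    and "\<And>\<gamma>. (\<Sum>k\<le>n. fps_nth f k * \<gamma> ^ k) = 0 \<Longrightarrow> norm \<gamma> < 1"
  shows "\<exists>\<alpha>s. length \<alpha>s = n \<and> set \<alpha>s \<subseteq> \<bbbB>\<^sub>1 \<and> f = prod_list (map (\<lambda>\<alpha>. fps_X - fps_const \<alpha>) \<alpha>s)"
  using assms
proof (induction n arbitrary: f)
  case 0
  then have "f = 1"
    by (auto simp: fps_eq_iff)
  then show ?case
    by simp
next
  case (Suc n)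
  obtain \<alpha> where \<alpha>: "(\<Sum>k\<le>Suc n. \<alpha> ^ k * fps_nth f k) = 0"
    using exists_left_root[of "Suc n" "fps_nth f"] Suc.prems(2) by auto
  then have "norm \<alpha> < 1"
    using left_root_imp_right_root Suc.prems(3) by metis
  \<comment> \<open>Horner's quotient for division by \<open>fps_X - fps_const \<alpha>\<close> on
    the left; the remainder is the left value at \<alpha>.\<close>
  define q where "q = Abs_fps (\<lambda>k. \<Sum>j=Suc k..Suc n. \<alpha> ^ (j - Suc k) * fps_nth f j)"
  have step: "fps_nth q k = fps_nth f (Suc k) + \<alpha> * fps_nth q (Suc k)" if "k \<le> n" for k
  proof -
    have "fps_nth q k = fps_nth f (Suc k) + (\<Sum>j=Suc (Suc k)..Suc n. \<alpha> ^ (j - Suc k) * fps_nth f j)"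
      using that by (simp only: q_def fps_nth_Abs_fps) (subst sum.atLeast_Suc_atMost; simp)
    also have "(\<Sum>j=Suc (Suc k)..Suc n. \<alpha> ^ (j - Suc k) * fps_nth f j) = \<alpha> * fps_nth q (Suc k)"
      unfolding q_def fps_nth_Abs_fps sum_distrib_left mult.assoc[symmetric] power_Suc[symmetric]
      by (intro sum.cong) (auto simp: Suc_diff_Suc simp del: power_Suc)
    finally show ?thesis .
  qed
  have big: "fps_nth q k = 0" if "k > n" for k
    using that by (simp add: q_def)
  have f_eq: "f = (fps_X - fps_const \<alpha>) * q"
  proof (rule fps_ext)
    fix k
    show "fps_nth f k = fps_nth ((fps_X - fps_const \<alpha>) * q) k"
    proof (cases k)
      case 0
      have "fps_nth f 0 + \<alpha> * fps_nth q 0 = (\<Sum>k\<le>Suc n. \<alpha> ^ k * fps_nth f k)"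
        unfolding sum.atMost_Suc_shift q_def fps_nth_Abs_fps sum_distrib_left mult.assoc[symmetric]
        by (simp only: sum.shift_bounds_cl_Suc_ivl) (simp add: atMost_atLeast0 mult.assoc)
      then show ?thesis
        using \<alpha> 0 by (simp add: fps_X_minus_mult_nth eq_neg_iff_add_eq_0)
    next
      case (Suc j)
      then show ?thesis
        using step[of j] big[of j] big[of k] Suc.prems(1)[of k]
        by (cases "j \<le> n") (simp_all add: fps_X_minus_mult_nth)
    qed
  qed
  have "\<exists>\<alpha>s. length \<alpha>s = n \<and> set \<alpha>s \<subseteq> \<bbbB>\<^sub>1 \<and> q = prod_list (map (\<lambda>\<alpha>. fps_X - fps_const \<alpha>) \<alpha>s)"
  proof (rule Suc.IH)
    show "fps_nth q k = 0" if "k > n" for k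
      using that by (rule big)
    show "fps_nth q n = 1"
      using step[of n] big[of "Suc n"] Suc.prems(2) by simp
    fix \<gamma> :: quat
    assume *: "(\<Sum>k\<le>n. fps_nth q k * \<gamma> ^ k) = 0"
    have "(\<Sum>k\<le>Suc n. fps_nth f k * \<gamma> ^ k) =
        (\<Sum>k\<le>Suc n. (case k of 0 \<Rightarrow> 0 | Suc j \<Rightarrow> fps_nth q j) * \<gamma> ^ k) - \<alpha> * (\<Sum>k\<le>Suc n. fps_nth q k * \<gamma> ^ k)"
      unfolding f_eq fps_X_minus_mult_nth
      by (simp only: left_diff_distrib sum_subtractf sum_distrib_left mult.assoc)
    also have "(\<Sum>k\<le>Suc n. fps_nth q k * \<gamma> ^ k) = 0"
      using * big[of "Suc n"] by simp
    also have "(\<Sum>k\<le>Suc n. (case k of 0 \<Rightarrow> 0 | Suc j \<Rightarrow> fps_nth q j) * \<gamma> ^ k)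
        = (\<Sum>k\<le>n. fps_nth q k * \<gamma> ^ k) * \<gamma>"
      by (simp only: sum.atMost_Suc_shift sum_distrib_right) (simp add: mult.assoc power_commutes)
    finally show "norm \<gamma> < 1"
      using * by (intro Suc.prems(3)) simp
  qed
  then obtain \<alpha>s where "length \<alpha>s = n" "set \<alpha>s \<subseteq> \<bbbB>\<^sub>1" "q = prod_list (map (\<lambda>\<alpha>. fps_X - fps_const \<alpha>) \<alpha>s)"
    by blast
  then have "length (\<alpha> # \<alpha>s) = Suc n \<and> set (\<alpha> # \<alpha>s) \<subseteq> \<bbbB>\<^sub>1 \<and>
      f = prod_list (map (\<lambda>\<alpha>. fps_X - fps_const \<alpha>) (\<alpha> # \<alpha>s))"
    using \<open>norm \<alpha> < 1\<close> by (simp add: f_eq)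
  then show ?case
    by blast
qed


section \<open>Absolutely summable power series\<close>

text \<open>\<open>H2\<close> is not closed under the Cauchy product, and its series need not
  converge at 1. Absolutely summable series lie in \<open>H2\<close>, form a ring and can be
  evaluated at 1.\<close>

definition l1 :: "quat fps set" where
  "l1 = {f. summable (\<lambda>k. norm (fps_nth f k))}"

lemma l1_finite: "(\<And>k. k > n \<Longrightarrow> fps_nth f k = 0) \<Longrightarrow> f \<in> l1"
  unfolding l1_def mem_Collect_eq by (rule summable_finite[of "{..n}"]) simp_all

lemma l1_const [simp]: "fps_const c \<in> l1"
  and l1_X_power [simp]: "fps_X ^ m \<in> l1"
  by (rule l1_finite[of m]; simp add: fps_X_power_nth)+

lemma l1_1 [simp]: "1 \<in> l1" and l1_X [simp]: "fps_X \<in> l1"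
  using l1_const[of 1] l1_X_power[of 1] by simp_all

lemma l1_add [intro]: "f \<in> l1 \<Longrightarrow> g \<in> l1 \<Longrightarrow> f + g \<in> l1"
  unfolding l1_def mem_Collect_eq
  by (rule summable_comparison_test'
      [OF summable_add[of "\<lambda>k. norm (fps_nth f k)" "\<lambda>k. norm (fps_nth g k)"]])
    (simp_all add: norm_triangle_ineq)

lemma l1_uminus [intro]: "f \<in> l1 \<Longrightarrow> - f \<in> l1"
  by (simp add: l1_def)

lemma l1_diff [intro]: "f \<in> l1 \<Longrightarrow> g \<in> l1 \<Longrightarrow> f - g \<in> l1"
  using l1_add[of f "- g"] by (simp add: l1_uminus)

lemma l1_mult [intro]:
  assumes "f \<in> l1" "g \<in> l1"
  shows "f * g \<in> l1"
proof -
  have "summable (\<lambda>k. \<Sum>i\<le>k. norm (fps_nth f i) * norm (fps_nth g (k - i)))"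
    using assms by (intro summable_Cauchy_product) (auto simp: l1_def)
  moreover have "norm (fps_nth (f * g) k) \<le> (\<Sum>i\<le>k. norm (fps_nth f i) * norm (fps_nth g (k - i)))" for k
    unfolding fps_mult_nth atMost_atLeast0
    by (rule order_trans[OF norm_sum]) (simp add: norm_mult)
  ultimately show ?thesis
    unfolding l1_def by (auto intro: summable_comparison_test')
qed

lemma l1_geometric: "norm a < 1 \<Longrightarrow> Abs_fps (\<lambda>k. a ^ k) \<in> l1"
  by (simp add: l1_def norm_power summable_geometric)

text \<open>The value at z = 1. As 1 is central, left and right values agree there and evaluation
  respects products.\<close>

definition coeff_sum :: "quat fps \<Rightarrow> quat" where
  "coeff_sum f = (\<Sum>k. fps_nth f k)"

lemma l1_summable: "f \<in> l1 \<Longrightarrow> summable (fps_nth f)"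
  unfolding l1_def by (auto intro: summable_norm_cancel)

lemma coeff_sum_mult: "f \<in> l1 \<Longrightarrow> g \<in> l1 \<Longrightarrow> coeff_sum (f * g) = coeff_sum f * coeff_sum g"
  unfolding coeff_sum_def fps_mult_nth atMost_atLeast0[symmetric]
  by (rule Cauchy_product[symmetric]) (auto simp: l1_def)

lemma coeff_sum_diff: "f \<in> l1 \<Longrightarrow> g \<in> l1 \<Longrightarrow> coeff_sum (f - g) = coeff_sum f - coeff_sum g"
  by (simp add: coeff_sum_def suminf_diff l1_summable)

lemma coeff_sum_const [simp]: "coeff_sum (fps_const c) = c"
  unfolding coeff_sum_def by (subst suminf_finite[of "{0}"]) auto

lemma coeff_sum_1 [simp]: "coeff_sum 1 = 1"
  using coeff_sum_const[of 1] by simp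

lemma coeff_sum_X [simp]: "coeff_sum fps_X = 1"
  unfolding coeff_sum_def by (subst suminf_finite[of "{1}"]) auto

text \<open>The conjugated factor stands on the left so that left multiplication by a constant c has
  left multiplication by \<open>qcnj c\<close> as its adjoint; Blaschke factors act from the
  left.\<close>

definition ip :: "quat fps \<Rightarrow> quat fps \<Rightarrow> quat" where
  "ip f g = (\<Sum>k. qcnj (fps_nth g k) * fps_nth f k)"

lemma l1_bounded:
  assumes "f \<in> l1"
  obtains K where "\<And>k. norm (fps_nth f k) \<le> K"
proof -
  have "(\<lambda>k. norm (fps_nth f k)) \<longlonglongrightarrow> 0"
    using assms unfolding l1_def by (auto intro: summable_LIMSEQ_zero)
  then have "Bseq (\<lambda>k. norm (fps_nth f k))"
    by (auto intro: convergent_imp_Bseq convergentI)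
  then show ?thesis
    using that by (auto simp: Bseq_def)
qed

lemma summable_mult_l1:
  assumes "f \<in> l1" "g \<in> l1"
  shows "summable (\<lambda>k. norm (fps_nth f k) * norm (fps_nth g k))"
proof -
  obtain K where K: "\<And>k. norm (fps_nth f k) \<le> K"
    using l1_bounded[OF assms(1)] by blast
  show ?thesis
  proof (rule summable_comparison_test')
    show "summable (\<lambda>k. K * norm (fps_nth g k))"
      using assms(2) by (simp add: l1_def summable_mult)
    show "norm (norm (fps_nth f k) * norm (fps_nth g k)) \<le> K * norm (fps_nth g k)" for k
      by (simp add: mult_right_mono K)
  qed
qed

lemma l1_imp_H2: "f \<in> l1 \<Longrightarrow> f \<in> H2"
  using summable_mult_l1[of f f] by (simp add: H2_def power2_eq_square)

lemma ip_sums: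
  assumes "f \<in> l1" "g \<in> l1"
  shows "(\<lambda>k. qcnj (fps_nth g k) * fps_nth f k) sums ip f g"
  unfolding ip_def
  by (rule summable_sums, rule summable_norm_cancel)
    (simp add: norm_mult summable_mult_l1[OF assms(2,1)])

lemma ip_diff_left:
  assumes "f \<in> l1" "g \<in> l1" "h \<in> l1"
  shows "ip (f - g) h = ip f h - ip g h"
  using sums_diff[OF ip_sums[OF assms(1,3)] ip_sums[OF assms(2,3)]] ip_sums[of "f - g" h] assms
  by (auto simp: right_diff_distrib intro: sums_unique2)

lemma ip_diff_right:
  assumes "f \<in> l1" "g \<in> l1" "h \<in> l1"
  shows "ip h (f - g) = ip h f - ip h g"
  using sums_diff[OF ip_sums[OF assms(3,1)] ip_sums[OF assms(3,2)]] ip_sums[of h "f - g"] assms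
  by (auto simp: left_diff_distrib intro: sums_unique2)

lemma ip_const_left: "ip (fps_const c * f) g = ip f (fps_const (qcnj c) * g)"
  by (simp add: ip_def qcnj_mult mult.assoc)

lemma ip_X_X:
  assumes "f \<in> l1" "g \<in> l1"
  shows "ip (fps_X * f) (fps_X * g) = ip f g"
proof -
  have "(\<lambda>k. qcnj (fps_nth (fps_X * g) (Suc k)) * fps_nth (fps_X * f) (Suc k)) sums ip f g"
    using ip_sums[OF assms] by simp
  then have "(\<lambda>k. qcnj (fps_nth (fps_X * g) k) * fps_nth (fps_X * f) k) sums ip f g"
    by (subst (asm) sums_Suc_iff) simp
  then show ?thesis
    using ip_sums[OF l1_mult[OF l1_X assms(1)] l1_mult[OF l1_X assms(2)]] sums_unique2 by blast
qed

lemma ip_X_power: "ip f (fps_X ^ m) = fps_nth f m"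
proof -
  have "ip f (fps_X ^ m) = (\<Sum>k\<in>{m}. qcnj (fps_nth (fps_X ^ m) k) * fps_nth f k)"
    unfolding ip_def by (rule suminf_finite) (auto simp: fps_X_power_nth)
  then show ?thesis
    by (simp add: fps_X_power_nth)
qed


section \<open>Blaschke products and invertible linear factors\<close>

lemma fps_linear_l1 [simp]: "fps_const c + fps_const d * fps_X \<in> l1"
  by (simp add: l1_add l1_mult)

text \<open>Geometric series for c (1 + c^(-1) d z).\<close>

lemma fps_linear_inverse:
  assumes "norm d < norm c"
  defines "h \<equiv> Abs_fps (\<lambda>k. (- inverse c * d) ^ k) * fps_const (inverse c)"
  shows "h \<in> l1" "(fps_const c + fps_const d * fps_X) * h = 1" "h * (fps_const c + fps_const d * fps_X) = 1"
proof -
  have "c \<noteq> 0"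
    using assms by auto
  have "norm (- inverse c * d) = norm d / norm c"
    by (simp add: norm_mult norm_inverse divide_inverse mult.commute)
  then have "norm (- inverse c * d) < 1"
    using assms \<open>c \<noteq> 0\<close> by simp
  then show "h \<in> l1"
    unfolding h_def by (intro l1_mult l1_geometric l1_const)
  have "c * ((- inverse c * d) * x) + d * x = 0" for x
    using \<open>c \<noteq> 0\<close> by (simp add: mult.assoc[symmetric])
  then show "(fps_const c + fps_const d * fps_X) * h = 1"
    using \<open>c \<noteq> 0\<close> unfolding fps_eq_iff fps_linear_mult_nth(1)
    by (auto simp: h_def mult.assoc split: nat.split)
  have "(- inverse c * d) ^ Suc k * inverse c * c + (- inverse c * d) ^ k * inverse c * d = 0" for k
    using \<open>c \<noteq> 0\<close> unfolding power_Suc2 by (simp add: mult.assoc)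
  then show "h * (fps_const c + fps_const d * fps_X) = 1"
    using \<open>c \<noteq> 0\<close> unfolding fps_eq_iff fps_linear_mult_nth(2)
    by (auto simp: h_def simp del: power_Suc split: nat.split)
qed

lemma blaschke_kernel:
  assumes "norm \<alpha> < 1"
  defines "h \<equiv> Abs_fps (\<lambda>k. qcnj \<alpha> ^ k)"
  shows "h \<in> l1" "h * (1 - fps_const (qcnj \<alpha>) * fps_X) = 1" "(1 - fps_const (qcnj \<alpha>) * fps_X) * h = 1"
  using fps_linear_inverse[of "- qcnj \<alpha>" 1] assms
  by (simp_all add: fps_const_neg[symmetric] del: fps_const_neg)

lemma blaschke_factor_mult_kernel:
  assumes "norm \<alpha> < 1"
  shows "blaschke_factor \<alpha> * (1 - fps_const (qcnj \<alpha>) * fps_X) = fps_X - fps_const \<alpha>"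
  unfolding blaschke_factor_def mult.assoc blaschke_kernel(2)[OF assms] by simp

lemma l1_blaschke_factor: "norm \<alpha> < 1 \<Longrightarrow> blaschke_factor \<alpha> \<in> l1"
  unfolding blaschke_factor_def by (intro l1_mult l1_diff blaschke_kernel l1_X l1_const)

text \<open>With F and G obtained from f and g by the geometric kernel, the claim compares the
  pairing of (z - \<alpha>) F, (z - \<alpha>) G with that of (1 - \<open>qcnj \<alpha>\<close> z) F,
  (1 - \<open>qcnj \<alpha>\<close> z) G. The cross terms agree by adjointness. The diagonal terms
  agree because the shift is isometric and both constants scale the pairing by the squared modulus
  of \<alpha>.\<close>

lemma ip_blaschke_factor:
  assumes "norm \<alpha> < 1" "f \<in> l1" "g \<in> l1"
  shows "ip (blaschke_factor \<alpha> * f) (blaschke_factor \<alpha> * g) = ip f g"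
proof -
  define k where "k = Abs_fps (\<lambda>k. qcnj \<alpha> ^ k)"
  define F G where "F = k * f" and "G = k * g"
  have l1: "F \<in> l1" "G \<in> l1"
    unfolding F_def G_def k_def using assms by (auto intro: blaschke_kernel)
  let ?a = "fps_const \<alpha>" and ?a' = "fps_const (qcnj \<alpha>)"
  have b: "blaschke_factor \<alpha> * f = fps_X * F - ?a * F" "blaschke_factor \<alpha> * g = fps_X * G - ?a * G"
    by (simp_all add: blaschke_factor_def F_def G_def k_def left_diff_distrib mult.assoc)
  have "(1 - ?a' * fps_X) * F = f" "(1 - ?a' * fps_X) * G = g"
    unfolding F_def G_def k_def mult.assoc[symmetric] blaschke_kernel(3)[OF assms(1)] by simp_all
  then have fg: "f = F - ?a' * (fps_X * F)" "g = G - ?a' * (fps_X * G)"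
    by (simp_all add: left_diff_distrib mult.assoc)
  have "ip (?a' * (fps_X * F)) (?a' * (fps_X * G)) = ip (?a * F) (?a * G)"
  proof -
    have "ip (?a' * (fps_X * F)) (?a' * (fps_X * G)) = ip (fps_X * F) (fps_const (\<alpha> * qcnj \<alpha>) * (fps_X * G))"
      unfolding ip_const_left qcnj_qcnj by (simp only: mult.assoc[symmetric] fps_const_mult)
    \<comment> \<open>Both products are the real number \<open>(norm \<alpha>)\<^sup>2\<close>, so
      they may change place and commute with everything.\<close>
    also have "fps_const (\<alpha> * qcnj \<alpha>) * (fps_X * G) = fps_X * (fps_const (qcnj \<alpha> * \<alpha>) * G)"
      unfolding mult_qcnj_norm qcnj_mult_norm by (metis fps_mult_fps_X_commute mult.assoc)
    also have "ip (fps_X * F) (fps_X * (fps_const (qcnj \<alpha> * \<alpha>) * G)) = ip F (fps_const (qcnj \<alpha> * \<alpha>) * G)"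
      using l1 by (intro ip_X_X) auto
    also have "\<dots> = ip (?a * F) (?a * G)"
      unfolding ip_const_left by (simp only: mult.assoc[symmetric] fps_const_mult)
    finally show ?thesis .
  qed
  then have "ip (F - ?a' * (fps_X * F)) (G - ?a' * (fps_X * G)) = ip (fps_X * F - ?a * F) (fps_X * G - ?a * G)"
    using l1 ip_const_left[of \<alpha> F "fps_X * G"] ip_const_left[of "qcnj \<alpha>" "fps_X * F" G]
    by (simp add: ip_diff_left ip_diff_right ip_X_X l1_mult l1_diff)
  then show ?thesis
    unfolding b by (simp only: fg[symmetric])
qed

text \<open>At 1 the kernel identity reads b(1) (1 - \<open>qcnj \<alpha>\<close>) = 1 - \<alpha>,
  and the two differences are conjugate to each other.\<close>

lemma norm_coeff_sum_blaschke_factor: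
  assumes "norm \<alpha> < 1"
  shows "norm (coeff_sum (blaschke_factor \<alpha>)) = 1"
proof -
  have "coeff_sum (blaschke_factor \<alpha>) * (1 - qcnj \<alpha>) = 1 - \<alpha>"
    using arg_cong[OF blaschke_factor_mult_kernel[OF assms], of coeff_sum]
    by (simp add: coeff_sum_mult coeff_sum_diff l1_blaschke_factor assms l1_mult l1_diff)
  moreover have "norm (1 - qcnj \<alpha>) = norm (1 - \<alpha>)"
    using norm_qcnj[of "1 - \<alpha>"] by simp
  moreover have "norm (1 - \<alpha>) \<noteq> 0"
    using assms by auto
  ultimately show ?thesis
    by (metis norm_mult mult_cancel_right2)
qed

lemma blaschke_list:
  assumes "set \<beta>s \<subseteq> \<bbbB>\<^sub>1"
  defines "B \<equiv> prod_list (map blaschke_factor \<beta>s)"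
  shows "B \<in> l1" "norm (coeff_sum B) = 1"
    "f \<in> l1 \<Longrightarrow> g \<in> l1 \<Longrightarrow> ip (B * f) (B * g) = ip f g"
proof -
  have "B \<in> l1 \<and> norm (coeff_sum B) = 1 \<and> (\<forall>f\<in>l1. \<forall>g\<in>l1. ip (B * f) (B * g) = ip f g)"
    using assms(1) unfolding B_def
  proof (induction \<beta>s)
    case (Cons \<beta> \<beta>s)
    then have "norm \<beta> < 1"
      by simp
    with Cons show ?case
      by (simp add: coeff_sum_mult l1_blaschke_factor norm_mult norm_coeff_sum_blaschke_factor
          ip_blaschke_factor mult.assoc l1_mult)
  qed simp
  then show "B \<in> l1" "norm (coeff_sum B) = 1"
    "f \<in> l1 \<Longrightarrow> g \<in> l1 \<Longrightarrow> ip (B * f) (B * g) = ip f g"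
    by auto
qed

text \<open>Products of linear factors without zeros in the closed unit ball. The constant term of a
  factor is not normalized to 1, since moving the factor past
  \<open>fps_X - fps_const \<beta>\<close> changes it within its modulus.\<close>

inductive_set outer_poly :: "quat fps set" where
  one: "1 \<in> outer_poly"
| step: "norm d < norm c \<Longrightarrow> s \<in> outer_poly \<Longrightarrow> (fps_const c + fps_const d * fps_X) * s \<in> outer_poly"

lemma outer_poly_inverse:
  assumes "s \<in> outer_poly"
  obtains h where "h \<in> l1" "s * h = 1" "h * s = 1"
proof -
  have "\<exists>h\<in>l1. s * h = 1 \<and> h * s = 1"
    using assms
  proof induction
    case (step d c s)
    then obtain h where h: "h \<in> l1" "s * h = 1" "h * s = 1"
      by blast
    obtain k where k: "k \<in> l1" "(fps_const c + fps_const d * fps_X) * k = 1" "k * (fps_const c + fps_const d * fps_X) = 1"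
      using fps_linear_inverse[OF step(1)] by blast
    have "(fps_const c + fps_const d * fps_X) * s * (h * k) = (fps_const c + fps_const d * fps_X) * (s * h) * k"
      by (simp only: mult.assoc)
    moreover have "h * k * ((fps_const c + fps_const d * fps_X) * s) = h * (k * (fps_const c + fps_const d * fps_X)) * s"
      by (simp only: mult.assoc)
    ultimately show ?case
      using h k by (intro bexI[of _ "h * k"]) auto
  qed (auto intro: bexI[of _ 1])
  then show ?thesis
    using that by blast
qed

lemma outer_poly_l1: "s \<in> outer_poly \<Longrightarrow> s \<in> l1"
  by (induction rule: outer_poly.induct) (auto intro!: l1_mult)

text \<open>The quadratic on the left has \<beta> as a right zero, hence a left zero \<beta>' of
  equal modulus, which splits off on the left. Comparing constant terms gives \<beta>' c' = c
  \<beta> and so the modulus of c'. For \<beta> = 0 this equation says nothing about c', but then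
  the factor is the central variable.\<close>

lemma fps_linear_swap:
  fixes c d \<beta> :: quat
  obtains \<beta>' c' where "norm \<beta>' = norm \<beta>" "norm c' = norm c"
    "(fps_const c + fps_const d * fps_X) * (fps_X - fps_const \<beta>) =
     (fps_X - fps_const \<beta>') * (fps_const c' + fps_const d * fps_X)"
proof (cases "\<beta> = 0")
  case True
  then show ?thesis
    using that[of 0 c] by (simp add: fps_mult_fps_X_commute)
next
  case False
  define f where "f = (\<lambda>k::nat. if k = 0 then - c * \<beta> else if k = 1 then c - d * \<beta> else d)"
  have "(\<Sum>k\<le>2. f k * \<beta> ^ k) = 0"
    by (simp add: f_def numeral_2_eq_2 algebra_simps)
  then obtain \<beta>' where \<beta>': "norm \<beta>' = norm \<beta>" "(\<Sum>k\<le>2. \<beta>' ^ k * f k) = 0"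
    by (rule right_root_imp_left_root)
  define c' where "c' = c - d * \<beta> + \<beta>' * d"
  have c': "\<beta>' * c' = c * \<beta>"
    using \<beta>'(2) by (simp add: f_def c'_def numeral_2_eq_2 algebra_simps)
  then have "norm \<beta>' * norm c' = norm c * norm \<beta>"
    by (metis norm_mult)
  then have "norm c' = norm c"
    using \<beta>'(1) False by simp
  moreover have "(fps_const c + fps_const d * fps_X) * (fps_X - fps_const \<beta>) =
     (fps_X - fps_const \<beta>') * (fps_const c' + fps_const d * fps_X)"
  proof (rule fps_ext)
    fix k
    show "fps_nth ((fps_const c + fps_const d * fps_X) * (fps_X - fps_const \<beta>)) k =
      fps_nth ((fps_X - fps_const \<beta>') * (fps_const c' + fps_const d * fps_X)) k"
      unfolding fps_X_minus_mult_nth fps_linear_mult_nth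
      using c' by (auto simp: c'_def split: nat.split)
  qed
  ultimately show ?thesis
    using that \<beta>'(1) by blast
qed

lemma outer_poly_swap:
  assumes "s \<in> outer_poly"
  shows "\<exists>\<beta>' s'. norm \<beta>' = norm \<beta> \<and> s' \<in> outer_poly \<and>
           s * (fps_X - fps_const \<beta>) = (fps_X - fps_const \<beta>') * s'"
  using assms
proof induction
  case one
  then show ?case
    by (intro exI[of _ \<beta>] exI[of _ 1]) (simp add: outer_poly.one)
next
  case (step d c s)
  then obtain \<beta>1 s1 where 1: "norm \<beta>1 = norm \<beta>" "s1 \<in> outer_poly"
      "s * (fps_X - fps_const \<beta>) = (fps_X - fps_const \<beta>1) * s1"
    by blast
  obtain \<beta>2 c2 where 2: "norm \<beta>2 = norm \<beta>1" "norm c2 = norm c"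
    "(fps_const c + fps_const d * fps_X) * (fps_X - fps_const \<beta>1) =
     (fps_X - fps_const \<beta>2) * (fps_const c2 + fps_const d * fps_X)"
    using fps_linear_swap .
  have "(fps_const c + fps_const d * fps_X) * s * (fps_X - fps_const \<beta>) =
      (fps_X - fps_const \<beta>2) * ((fps_const c2 + fps_const d * fps_X) * s1)"
    unfolding mult.assoc 1(3) unfolding mult.assoc[symmetric] 2(3) ..
  moreover have "(fps_const c2 + fps_const d * fps_X) * s1 \<in> outer_poly"
    using step(1) 1(2) 2(2) by (intro outer_poly.step) auto
  ultimately show ?case
    using 1(1) 2(1) by metis
qed

text \<open>Each Blaschke factor is split off on the left as \<open>z - \<alpha> = b\<^sub>\<alpha> (1 - \<alpha>\<^sup>* z)\<close>; the remaining outer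
  factor is then moved to the right past the other linear factors.\<close>

lemma outer_poly_mult_linear_factors:
  assumes "set \<alpha>s \<subseteq> \<bbbB>\<^sub>1" "s \<in> outer_poly"
  shows "\<exists>\<beta>s s'. set \<beta>s \<subseteq> \<bbbB>\<^sub>1 \<and> s' \<in> outer_poly \<and>
           s * prod_list (map (\<lambda>\<alpha>. fps_X - fps_const \<alpha>) \<alpha>s) = prod_list (map blaschke_factor \<beta>s) * s'"
  using assms
proof (induction \<alpha>s arbitrary: s)
  case Nil
  then show ?case
    by (auto intro!: exI[of _ "[]"])
next
  case (Cons \<alpha> \<alpha>s)
  define q where "q = prod_list (map (\<lambda>\<alpha>. fps_X - fps_const \<alpha>) \<alpha>s)"
  obtain \<beta> s1 where 1: "norm \<beta> = norm \<alpha>" "s1 \<in> outer_poly"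
      "s * (fps_X - fps_const \<alpha>) = (fps_X - fps_const \<beta>) * s1"
    using outer_poly_swap[OF Cons.prems(2)] by blast
  have \<beta>: "norm \<beta> < 1"
    using Cons.prems(1) 1(1) by simp
  define s2 where "s2 = (1 - fps_const (qcnj \<beta>) * fps_X) * s1"
  have "(fps_const 1 + fps_const (- qcnj \<beta>) * fps_X) * s1 \<in> outer_poly"
    using \<beta> 1(2) by (intro outer_poly.step) simp_all
  then have "s2 \<in> outer_poly"
    unfolding s2_def by (simp add: fps_const_neg[symmetric] del: fps_const_neg)
  then obtain \<beta>s s' where IH: "set \<beta>s \<subseteq> \<bbbB>\<^sub>1" "s' \<in> outer_poly" "s2 * q = prod_list (map blaschke_factor \<beta>s) * s'"
    unfolding q_def using Cons.IH Cons.prems(1) by (metis list.set_intros(2) subset_code(1))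
  have "s * ((fps_X - fps_const \<alpha>) * q) = blaschke_factor \<beta> * (s2 * q)"
    unfolding mult.assoc[symmetric] 1(3) s2_def blaschke_factor_mult_kernel[OF \<beta>] ..
  then have "s * prod_list (map (\<lambda>\<alpha>. fps_X - fps_const \<alpha>) (\<alpha> # \<alpha>s)) = prod_list (map blaschke_factor (\<beta> # \<beta>s)) * s'"
    by (simp add: q_def[symmetric] IH(3) mult.assoc)
  moreover have "set (\<beta> # \<beta>s) \<subseteq> \<bbbB>\<^sub>1"
    using \<beta> IH(1) by simp
  ultimately show ?case
    using IH(2) by blast
qed

text \<open>A right zero of the right factor persists in a product, since new coefficients only
  enter on the left of those of g. The form \<open>sums 0\<close> carries convergence along.\<close>

lemma right_value_linear_mult:
  fixes g :: "quat fps"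
  assumes "(\<lambda>k. fps_nth g k * \<gamma> ^ k) sums 0"
  shows "(\<lambda>k. fps_nth ((fps_const c + fps_const d * fps_X) * g) k * \<gamma> ^ k) sums 0"
proof -
  have "(\<lambda>k. d * (fps_nth g k * \<gamma> ^ k) * \<gamma>) sums (d * 0 * \<gamma>)"
    by (rule sums_mult2[OF sums_mult[OF assms]])
  then have "(\<lambda>k. (case Suc k of 0 \<Rightarrow> 0 | Suc j \<Rightarrow> d * fps_nth g j) * \<gamma> ^ Suc k) sums 0"
    by (simp add: mult.assoc power_commutes)
  then have "(\<lambda>k. (case k of 0 \<Rightarrow> 0 | Suc j \<Rightarrow> d * fps_nth g j) * \<gamma> ^ k) sums 0"
    by (subst (asm) sums_Suc_iff) simp
  from sums_add[OF sums_mult[OF assms, of c] this] show ?thesis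
    unfolding fps_linear_mult_nth by (simp add: distrib_right mult.assoc)
qed

lemma left_value_linear_mult:
  fixes g :: "quat fps"
  assumes "(\<lambda>k. \<gamma> ^ k * fps_nth g k) sums 0"
  shows "(\<lambda>k. \<gamma> ^ k * fps_nth (g * (fps_const c + fps_const d * fps_X)) k) sums 0"
proof -
  have "(\<lambda>k. \<gamma> * ((\<gamma> ^ k * fps_nth g k) * d)) sums (\<gamma> * (0 * d))"
    by (rule sums_mult[OF sums_mult2[OF assms]])
  then have "(\<lambda>k. \<gamma> ^ Suc k * (case Suc k of 0 \<Rightarrow> 0 | Suc j \<Rightarrow> fps_nth g j * d)) sums 0"
    by (simp add: mult.assoc)
  then have "(\<lambda>k. \<gamma> ^ k * (case k of 0 \<Rightarrow> 0 | Suc j \<Rightarrow> fps_nth g j * d)) sums 0"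
    by (subst (asm) sums_Suc_iff) simp
  from sums_add[OF sums_mult2[OF assms, of c] this] show ?thesis
    unfolding fps_linear_mult_nth by (simp add: distrib_left mult.assoc)
qed

lemma right_value_outer_mult:
  "s \<in> outer_poly \<Longrightarrow> (\<lambda>k. fps_nth g k * \<gamma> ^ k) sums 0 \<Longrightarrow> (\<lambda>k. fps_nth (s * g) k * \<gamma> ^ k) sums 0"
  by (induction rule: outer_poly.induct) (simp_all add: mult.assoc right_value_linear_mult)

lemma left_value_outer_mult:
  "s \<in> outer_poly \<Longrightarrow> (\<lambda>k. \<gamma> ^ k * fps_nth g k) sums 0 \<Longrightarrow> (\<lambda>k. \<gamma> ^ k * fps_nth (g * s) k) sums 0"
  by (induction arbitrary: g rule: outer_poly.induct)
    (simp_all add: mult.assoc[symmetric] left_value_linear_mult)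

lemma summable_value:
  assumes "f \<in> l1" "norm \<gamma> < 1"
  shows "summable (\<lambda>k. fps_nth f k * \<gamma> ^ k)" "summable (\<lambda>k. \<gamma> ^ k * fps_nth f k)"
proof -
  have "norm (fps_nth f k) * norm \<gamma> ^ k \<le> norm (fps_nth f k)" for k
    using assms(2) by (intro mult_left_le power_le_one) auto
  then show "summable (\<lambda>k. fps_nth f k * \<gamma> ^ k)" "summable (\<lambda>k. \<gamma> ^ k * fps_nth f k)"
    using assms(1) unfolding l1_def
    by (auto intro!: summable_comparison_test'[of "\<lambda>k. norm (fps_nth f k)"]
        simp: norm_mult norm_power mult.commute)
qed

text \<open>A right zero of R would survive multiplication by s on the left and be a zero of \<phi>.
  For a left zero a factor on the right is needed: R is h \<phi> with h the inverse of s, so h would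
  have the zero, and with it h s = 1.\<close>

lemma no_zeros_if_outer_mult_const:
  assumes "R \<in> l1" "s \<in> outer_poly" "s * R = fps_const \<phi>" "\<phi> \<noteq> 0" "norm \<gamma> < 1"
  shows "\<not> left_zero R \<gamma>" "\<not> right_zero R \<gamma>"
proof -
  show "\<not> right_zero R \<gamma>"
  proof
    assume "right_zero R \<gamma>"
    then have "(\<lambda>k. fps_nth R k * \<gamma> ^ k) sums 0"
      using summable_sums[OF summable_value(1)[OF assms(1,5)]] by (simp add: right_zero_def right_value_def)
    then have "(\<lambda>k. fps_nth (s * R) k * \<gamma> ^ k) sums 0"
      by (rule right_value_outer_mult[OF assms(2)])
    moreover have "(\<lambda>k. fps_nth (s * R) k * \<gamma> ^ k) sums \<phi>"
      unfolding assms(3) using sums_finite[of "{0}" "\<lambda>k. fps_nth (fps_const \<phi>) k * \<gamma> ^ k"] by simp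
    ultimately show False
      using assms(4) sums_unique2 by blast
  qed
  obtain h where h: "s * h = 1" "h * s = 1"
    using outer_poly_inverse[OF assms(2)] by metis
  have R: "R = h * fps_const \<phi>"
    by (metis assms(3) h(2) mult.assoc mult_1)
  show "\<not> left_zero R \<gamma>"
  proof
    assume "left_zero R \<gamma>"
    then have "(\<lambda>k. \<gamma> ^ k * fps_nth R k) sums 0"
      using summable_sums[OF summable_value(2)[OF assms(1,5)]] by (simp add: left_zero_def left_value_def)
    from sums_mult2[OF this, of "inverse \<phi>"] have "(\<lambda>k. \<gamma> ^ k * fps_nth h k) sums 0"
      using assms(4) by (simp add: R mult.assoc)
    then have "(\<lambda>k. \<gamma> ^ k * fps_nth (h * s) k) sums 0"
      by (rule left_value_outer_mult[OF assms(2)])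
    moreover have "(\<lambda>k. \<gamma> ^ k * fps_nth (h * s) k) sums 1"
      unfolding h(2) using sums_finite[of "{0}" "\<lambda>k. \<gamma> ^ k * fps_nth 1 k"] by simp
    ultimately show False
      using sums_unique2 zero_neq_one by metis
  qed
qed


section \<open>Linear recursions\<close>

lemma summable_l1_mult:
  assumes "f \<in> l1" "g \<in> l1"
  shows "summable (\<lambda>k. fps_nth f k * fps_nth g k)"
  by (rule summable_norm_cancel[OF summable_mult_l1[OF assms, folded norm_mult]])

text \<open>A factor \<open>z - \<alpha>\<close> of the characteristic polynomial of the recursion turns it into
  \<open>u\<^sub>k\<^sub>+\<^sub>1 - u\<^sub>k \<alpha> = w\<^sub>k\<close>, where \<open>w\<close> satisfies the recursion of the remaining factors.\<close>

lemma linear_recursion_Cons: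
  fixes u :: "nat \<Rightarrow> 'a::ring_1"
  assumes "\<And>j. (\<Sum>i\<le>length (\<alpha> # \<alpha>s). u (i + j) *
            fps_nth (prod_list (map (\<lambda>\<alpha>. fps_X - fps_const \<alpha>) (\<alpha> # \<alpha>s))) i) = 0"
  shows "(\<Sum>i\<le>length \<alpha>s. (u (Suc (i + j)) - u (i + j) * \<alpha>) *
            fps_nth (prod_list (map (\<lambda>\<alpha>. fps_X - fps_const \<alpha>) \<alpha>s)) i) = 0"
proof -
  define q where "q = prod_list (map (\<lambda>\<alpha>. fps_X - fps_const \<alpha>) \<alpha>s)"
  have "fps_nth q k = 0" if "k > length \<alpha>s" for k
    unfolding q_def using that
  proof (induction \<alpha>s arbitrary: k)
    case (Cons \<alpha> \<alpha>s)
    from Cons.prems obtain j where "k = Suc j" "j > length \<alpha>s"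
      by (cases k) auto
    then show ?case
      using Cons.IH[of k] Cons.IH[of j] by (simp add: fps_X_minus_mult_nth)
  qed simp
  then have q0: "fps_nth q (Suc (length \<alpha>s)) = 0"
    by simp
  have "0 = (\<Sum>i\<le>Suc (length \<alpha>s). u (i + j) * fps_nth ((fps_X - fps_const \<alpha>) * q) i)"
    using assms[of j] by (simp add: q_def)
  also have "\<dots> = (\<Sum>i\<le>Suc (length \<alpha>s). u (i + j) * (case i of 0 \<Rightarrow> 0 | Suc i \<Rightarrow> fps_nth q i)) -
      (\<Sum>i\<le>Suc (length \<alpha>s). u (i + j) * \<alpha> * fps_nth q i)"
    unfolding fps_X_minus_mult_nth by (simp only: right_diff_distrib sum_subtractf mult.assoc)
  also have "\<dots> = (\<Sum>i\<le>length \<alpha>s. u (Suc (i + j)) * fps_nth q i) - (\<Sum>i\<le>length \<alpha>s. u (i + j) * \<alpha> * fps_nth q i)"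
    by (subst sum.atMost_Suc_shift) (simp add: q0)
  finally show ?thesis
    by (simp add: q_def left_diff_distrib sum_subtractf)
qed

text \<open>For generating series, U (1 - \<alpha> z) = u(0) + z W, where W belongs to the shorter
  recursion, and 1 - \<alpha> z is invertible in \<open>l1\<close>. This is the source of the decay
  of the powers of A.\<close>

lemma linear_recursion_l1:
  fixes u :: "nat \<Rightarrow> quat"
  assumes "set \<alpha>s \<subseteq> \<bbbB>\<^sub>1"
    and "\<And>j. (\<Sum>i\<le>length \<alpha>s. u (i + j) *
            fps_nth (prod_list (map (\<lambda>\<alpha>. fps_X - fps_const \<alpha>) \<alpha>s)) i) = 0"
  shows "Abs_fps u \<in> l1"
  using assms
proof (induction \<alpha>s arbitrary: u)
  case Nil
  then have "Abs_fps u = 0"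
    by (simp add: fps_eq_iff)
  then show ?case
    using l1_const[of 0] by simp
next
  case (Cons \<alpha> \<alpha>s)
  define w where "w k = u (Suc k) - u k * \<alpha>" for k
  have w: "Abs_fps w \<in> l1"
    using Cons.prems(1) linear_recursion_Cons[OF Cons.prems(2)]
    by (intro Cons.IH) (simp_all add: w_def)
  obtain h where h: "h \<in> l1" "(fps_const 1 + fps_const (- \<alpha>) * fps_X) * h = 1"
    using fps_linear_inverse(1,2)[of "- \<alpha>" 1] Cons.prems(1) by auto
  have "Abs_fps u * (fps_const 1 + fps_const (- \<alpha>) * fps_X) = fps_const (u 0) + fps_X * Abs_fps w"
    unfolding fps_eq_iff fps_linear_mult_nth by (auto simp: w_def split: nat.split)
  then have "Abs_fps u = (fps_const (u 0) + fps_X * Abs_fps w) * h"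
    by (metis h(2) mult.assoc mult_1_right)
  then show ?case
    using h(1) w by (simp add: l1_add l1_mult)
qed

text \<open>With q the product of the factors, the sum is formally that of (sum over i of u(i+j)
  q_i) D_j over j, and each inner sum vanishes. Peeling off one factor at a time replaces the
  interchange of a double series by an index shift.\<close>

lemma linear_recursion_sums_0:
  fixes u :: "nat \<Rightarrow> quat"
  assumes "Abs_fps u \<in> l1" "D \<in> l1"
    and "\<And>j. (\<Sum>i\<le>length \<alpha>s. u (i + j) *
            fps_nth (prod_list (map (\<lambda>\<alpha>. fps_X - fps_const \<alpha>) \<alpha>s)) i) = 0"
  shows "(\<lambda>k. u k * fps_nth (prod_list (map (\<lambda>\<alpha>. fps_X - fps_const \<alpha>) \<alpha>s) * D) k) sums 0"
  using assms(1,3)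
proof (induction \<alpha>s arbitrary: u)
  case Nil
  then show ?case
    by simp
next
  case (Cons \<alpha> \<alpha>s)
  define E where "E = prod_list (map (\<lambda>\<alpha>. fps_X - fps_const \<alpha>) \<alpha>s) * D"
  have "prod_list (map (\<lambda>\<alpha>. fps_X - fps_const \<alpha>) \<alpha>s) \<in> l1"
    by (induction \<alpha>s) (auto intro!: l1_mult l1_diff)
  then have E: "E \<in> l1"
    using assms(2) by (simp add: E_def l1_mult)
  have shift: "Abs_fps (\<lambda>k. u (Suc k)) \<in> l1"
    using Cons.prems(1) unfolding l1_def fps_nth_Abs_fps mem_Collect_eq
    by (subst summable_Suc_iff)
  have mult: "Abs_fps (\<lambda>k. u k * \<alpha>) \<in> l1"
    using Cons.prems(1) unfolding l1_def fps_nth_Abs_fps mem_Collect_eq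
    by (simp add: norm_mult summable_mult2)
  have "Abs_fps (\<lambda>k. u (Suc k) - u k * \<alpha>) \<in> l1"
    using l1_diff[OF shift mult] by (simp add: fps_minus_def)
  from Cons.IH[OF this linear_recursion_Cons[OF Cons.prems(2)]]
  have IH: "(\<lambda>k. (u (Suc k) - u k * \<alpha>) * fps_nth E k) sums 0"
    unfolding E_def .
  \<comment> \<open>The value of z is irrelevant: the shifted sum and the sum with \<alpha> both
    equal z and cancel.\<close>
  obtain z where z: "(\<lambda>k. u (Suc k) * fps_nth E k) sums z"
    using summable_l1_mult[OF shift E] by (auto simp: summable_def)
  have "(\<lambda>k. u k * \<alpha> * fps_nth E k) sums z"
    using sums_diff[OF z IH] by (simp add: left_diff_distrib)
  moreover have "(\<lambda>k. u k * (case k of 0 \<Rightarrow> 0 | Suc j \<Rightarrow> fps_nth E j)) sums z"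
    using sums_Suc[of "\<lambda>k. u k * (case k of 0 \<Rightarrow> 0 | Suc j \<Rightarrow> fps_nth E j)" z] z by simp
  ultimately have "(\<lambda>k. u k * (case k of 0 \<Rightarrow> 0 | Suc j \<Rightarrow> fps_nth E j) - u k * \<alpha> * fps_nth E k) sums (z - z)"
    by (intro sums_diff)
  moreover have "prod_list (map (\<lambda>\<alpha>. fps_X - fps_const \<alpha>) (\<alpha> # \<alpha>s)) * D = (fps_X - fps_const \<alpha>) * E"
    by (simp add: E_def mult.assoc)
  ultimately show ?case
    by (simp only: fps_X_minus_mult_nth right_diff_distrib mult.assoc diff_self)
qed


section \<open>Matrices of power series\<close>

lemma const_mat_mult: "const_mat (M ** N) = const_mat M ** const_mat (N :: quat^'p^'n)"
proof -
  have "fps_const (sum f S) = (\<Sum>i\<in>S. fps_const (f i))" for f :: "'n \<Rightarrow> quat" and S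
    by (simp add: fps_eq_iff fps_sum_nth)
  then show ?thesis
    by (simp add: vec_eq_iff matrix_matrix_mult_def)
qed

lemma const_mat_diff: "const_mat (M - N) = const_mat M - const_mat (N :: quat^'p^'n)"
  by (simp add: vec_eq_iff)

lemma const_mat_add: "const_mat (M + N) = const_mat M + const_mat (N :: quat^'p^'n)"
  by (simp add: vec_eq_iff)

lemma mat_matrix_mult_nth: "(mat c ** M) $ i $ j = c * M $ i $ j"
  for M :: "'a::semiring_1^'p^'n"
  by (simp add: matrix_matrix_mult_def mat_def mult_delta_left)

lemma matrix_mat_mult_nth: "(M ** mat c) $ i $ j = M $ i $ j * c"
  for M :: "'a::semiring_1^'n^'p"
  by (simp add: matrix_matrix_mult_def mat_def mult_delta_right)

lemma mat_fps_X_commute: "mat fps_X ** M = M ** mat fps_X" for M :: "'a::ring_1 fps^'p^'n"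
  by (simp add: vec_eq_iff mat_matrix_mult_nth matrix_mat_mult_nth fps_mult_fps_X_commute)

text \<open>\<open>Q\<close> is the Neumann series of the powers z^k M^k. Both products are computed
  because \<open>matrix_inv_eqI\<close> asks for a two-sided inverse.\<close>

lemma resolvent_inverse:
  fixes M :: "quat^'n^'n"
  defines "Q \<equiv> (\<chi> i j. Abs_fps (\<lambda>k. mat_power M k $ i $ j))"
  shows "(mat 1 - mat fps_X ** const_mat M) ** Q = mat 1"
    and "Q ** (mat 1 - mat fps_X ** const_mat M) = mat 1"
proof -
  have MQ: "fps_nth ((const_mat M ** Q) $ i $ j) k = mat_power M (Suc k) $ i $ j" for i j k
    by (simp add: Q_def matrix_matrix_mult_def fps_sum_nth)
  have QM: "fps_nth ((Q ** const_mat M) $ i $ j) k = mat_power M (Suc k) $ i $ j" for i j k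
    using mat_power_commute[of M k] by (simp add: Q_def matrix_matrix_mult_def fps_sum_nth vec_eq_iff)
  have Q: "fps_nth (Q $ i $ j) k = mat_power M k $ i $ j" for i j k
    by (simp add: Q_def)
  have one: "fps_nth ((mat 1 :: quat fps^'n^'n) $ i $ j) k = (case k of 0 \<Rightarrow> mat 1 $ i $ j | Suc _ \<Rightarrow> 0)" for i j k
    by (simp add: mat_def split: nat.split)
  have "fps_nth ((mat fps_X ** (const_mat M ** Q)) $ i $ j) k = fps_nth ((Q - mat 1) $ i $ j) k" for i j k
    by (cases k) (simp_all add: mat_matrix_mult_nth MQ Q one)
  then have "mat fps_X ** (const_mat M ** Q) = Q - mat 1"
    unfolding vec_eq_iff fps_eq_iff by blast
  then show "(mat 1 - mat fps_X ** const_mat M) ** Q = mat 1"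
    by (simp only: matrix_sub_rdistrib matrix_mul_assoc[symmetric] matrix_mul_lid) simp
  have "fps_nth ((mat fps_X ** (Q ** const_mat M)) $ i $ j) k = fps_nth ((Q - mat 1) $ i $ j) k" for i j k
    by (cases k) (simp_all add: mat_matrix_mult_nth QM Q one)
  then have "mat fps_X ** (Q ** const_mat M) = Q - mat 1"
    unfolding vec_eq_iff fps_eq_iff by blast
  moreover have "Q ** (mat fps_X ** const_mat M) = mat fps_X ** (Q ** const_mat M)"
    by (simp only: matrix_mul_assoc mat_fps_X_commute[of Q])
  ultimately show "Q ** (mat 1 - mat fps_X ** const_mat M) = mat 1"
    by (simp only: matrix_sub_ldistrib matrix_mul_rid) simp
qed

lemma resolvent_eq: "resolvent M = (\<chi> i j. Abs_fps (\<lambda>k. mat_power M k $ i $ j))"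
  unfolding resolvent_def by (rule matrix_inv_eqI resolvent_inverse)+

lemma resolvent_mult: "(mat 1 - mat fps_X ** const_mat M) ** resolvent M = mat 1"
  unfolding resolvent_eq by (rule resolvent_inverse)

lemma entry_resolvent:
  fixes r :: "quat^'n^1" and c :: "quat^1^'n"
  shows "entry (const_mat r ** resolvent M ** const_mat c) = Abs_fps (\<lambda>k. entry (r ** mat_power M k ** c))"
  unfolding fps_eq_iff
  by (simp add: matrix_matrix_mult_def resolvent_eq fps_sum_nth sum_distrib_right)


section \<open>The companion matrix\<close>

lemma idx_inj: "idx (i :: 'n::{finite,linorder}) = idx j \<longleftrightarrow> i = j"
proof -
  have "idx i < idx j" if "i < j" for i j :: 'n
    unfolding idx_def atMost_def[symmetric] using that
    by (intro psubset_card_mono) (auto simp: psubset_eq)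
  then show ?thesis
    by (metis less_irrefl linorder_cases)
qed

lemma idx_range: "1 \<le> idx (i :: 'n::{finite,linorder})" "idx i \<le> CARD('n)"
proof -
  have "card {i} \<le> idx i"
    unfolding idx_def by (intro card_mono) auto
  then show "1 \<le> idx i"
    by simp
  show "idx i \<le> CARD('n)"
    unfolding idx_def by (intro card_mono) auto
qed

lemma bij_betw_idx: "bij_betw (\<lambda>i :: 'n::{finite,linorder}. idx i - 1) UNIV {..<CARD('n)}"
proof -
  have inj: "inj (\<lambda>i :: 'n. idx i - 1)"
  proof (rule injI)
    fix i j :: 'n
    assume "idx i - 1 = idx j - 1"
    then have "idx i = idx j"
      using idx_range(1)[of i] idx_range(1)[of j] by linarith
    then show "i = j"
      by (simp add: idx_inj)
  qed
  have "idx i - 1 < CARD('n)" for i :: 'n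
    using idx_range[of i] by linarith
  then have "(\<lambda>i :: 'n. idx i - 1) ` UNIV \<subseteq> {..<CARD('n)}"
    by auto
  then have "(\<lambda>i :: 'n. idx i - 1) ` UNIV = {..<CARD('n)}"
    by (intro card_subset_eq) (use card_image[OF inj] in simp_all)
  then show ?thesis
    using inj by (simp add: bij_betw_def)
qed

lemma sum_idx: "(\<Sum>i :: 'n::{finite,linorder} \<in> UNIV. f (idx i - 1)) = (\<Sum>k<CARD('n). f k)"
  using sum.reindex_bij_betw[OF bij_betw_idx] .

lemma idx_surj:
  assumes "k < CARD('n)"
  obtains i :: "'n::{finite,linorder}" where "idx i = Suc k"
proof -
  have "k \<in> range (\<lambda>i :: 'n. idx i - 1)"
    unfolding bij_betw_imp_surj_on[OF bij_betw_idx] using assms by simp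
  then obtain i :: 'n where "k = idx i - 1"
    by (rule rangeE)
  then show ?thesis
    using that[of i] idx_range(1)[of i] by simp
qed

lemma matrix_mult_e_col_nth: "(M ** e_col (idx j)) $ i $ l = M $ i $ j"
  for M :: "quat^'n::{finite,linorder}^'m"
  by (simp add: matrix_matrix_mult_def e_col_def idx_inj mult_delta_right)

lemma companion_power_e_col:
  assumes "k < CARD('n)"
  shows "mat_power (companion p) k ** e_col 1 = (e_col (Suc k) :: quat^1^'n::{finite,linorder})"
  using assms
proof (induction k)
  case (Suc k)
  then have IH: "mat_power (companion p) k ** e_col 1 = (e_col (Suc k) :: quat^1^'n::{finite,linorder})"
    by simp
  obtain j :: 'n where j: "idx j = Suc k"
    using idx_surj[of k, where 'n = 'n] Suc.prems by auto
  have "(companion p ** e_col (Suc k)) $ i $ l = (e_col (Suc (Suc k)) :: quat^1^'n::{finite,linorder}) $ i $ l" for i l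
    using Suc.prems by (simp only: j[symmetric] matrix_mult_e_col_nth) (simp add: companion_def e_col_def j)
  then have step: "companion p ** e_col (Suc k) = (e_col (Suc (Suc k)) :: quat^1^'n::{finite,linorder})"
    by (simp add: vec_eq_iff)
  then show ?case
    by (simp only: mat_power.simps matrix_mul_assoc[symmetric] IH step)
qed simp

text \<open>Since lower powers of C applied to e_1 give the unit columns, this is the relation that
  the columns C^k e_1 p_k sum to 0, with the coefficients on the right.\<close>

lemma companion_power_card_e_col:
  "mat_power (companion p) CARD('n) ** e_col 1 =
    (\<chi> i _. - coeff p (idx i - 1) :: quat^1^'n::{finite,linorder})"
proof -
  obtain n where n: "CARD('n) = Suc n"
    using zero_less_card_finite[where 'a = 'n] gr0_implies_Suc by blast
  obtain j :: 'n where j: "idx j = Suc n"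
    using idx_surj[of n, where 'n = 'n] n by auto
  have "mat_power (companion p) CARD('n) ** e_col 1 = companion p ** (e_col (Suc n) :: quat^1^'n::{finite,linorder})"
    using companion_power_e_col[of n p, where 'n = 'n] n
    by (simp only: mat_power.simps matrix_mul_assoc[symmetric])
  also have "\<dots> = (\<chi> i _. - coeff p (idx i - 1))"
    unfolding vec_eq_iff by (simp only: j[symmetric] matrix_mult_e_col_nth) (simp add: companion_def j n)
  finally show ?thesis .
qed

lemma row_idx_mult_const_mat:
  "(\<chi> _ j. fps_X ^ (idx j - 1)) ** const_mat (\<chi> i _. f (idx i - 1) :: quat^1^'n::{finite,linorder}) =
   mat (\<Sum>k<CARD('n). fps_X ^ k * fps_const (f k))"
proof -
  have "(\<Sum>j::'n\<in>UNIV. fps_X ^ (idx j - 1) * fps_const (f (idx j - 1))) = (\<Sum>k<CARD('n). fps_X ^ k * fps_const (f k))"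
    by (rule sum_idx)
  then show ?thesis
    by (simp add: vec_eq_iff matrix_matrix_mult_def mat_def)
qed

lemma monic_fps_of_poly:
  fixes p :: "quat poly"
  assumes "degree p = n" "lead_coeff p = 1"
  shows "fps_of_poly p = fps_X ^ n + (\<Sum>k<n. fps_X ^ k * fps_const (coeff p k))"
proof (rule fps_ext)
  fix m
  have "fps_nth (\<Sum>k<n. fps_X ^ k * fps_const (coeff p k)) m = (\<Sum>k<n. if m = k then coeff p k else 0)"
    by (simp add: fps_sum_nth mult_delta_left)
  also have "\<dots> = (if m < n then coeff p m else 0)"
    by simp
  finally show "fps_nth (fps_of_poly p) m = fps_nth (fps_X ^ n + (\<Sum>k<n. fps_X ^ k * fps_const (coeff p k))) m"
    using assms by (auto simp: fps_X_power_nth not_less coeff_eq_0)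
qed

text \<open>Multiplication by the companion matrix shifts the row of powers by one place. Only in
  the last column does the shift leave the row, and replacing z^n there by lower powers costs
  exactly p.\<close>

lemma row_mult_companion:
  fixes p :: "quat poly"
  assumes "degree p = CARD('n)" "lead_coeff p = 1"
  defines "Z \<equiv> \<chi> _ j. fps_X ^ (idx j - 1) :: quat fps^'n::{finite,linorder}^1"
  shows "mat (fps_of_poly p) ** const_mat (adj (e_col CARD('n) :: quat^1^'n::{finite,linorder})) =
    Z ** (mat fps_X - const_mat (companion p))"
proof -
  have "(Z ** const_mat (companion p)) $ l $ j =
      Z $ l $ j * fps_X - fps_of_poly p * fps_const (adj (e_col CARD('n) :: quat^1^'n::{finite,linorder}) $ l $ j)" for l j
  proof (cases "idx j < CARD('n)")
    case True
    then obtain i :: 'n where i: "idx i = Suc (idx j)"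
      using idx_surj by blast
    have "idx k = Suc (idx j) \<longleftrightarrow> k = i" for k
      using idx_inj[of k i] i by simp
    then have "(Z ** const_mat (companion p)) $ l $ j = (\<Sum>k\<in>UNIV. if k = i then fps_X ^ (idx k - 1) else 0)"
      using True by (simp add: matrix_matrix_mult_def Z_def companion_def e_col_def if_distrib[of fps_const] mult_delta_right cong: if_cong)
    also have "\<dots> = fps_X ^ (idx j - 1) * fps_X"
      using i idx_range(1)[of j] by (simp add: power_Suc2[symmetric] del: power_Suc)
    finally show ?thesis
      using True by (simp add: Z_def adj_def e_col_def)
  next
    case False
    then have j: "idx j = CARD('n)"
      using idx_range(2)[of j] by simp
    have "(Z ** const_mat (companion p)) $ l $ j = (\<Sum>i::'n\<in>UNIV. fps_X ^ (idx i - 1) * fps_const (- coeff p (idx i - 1)))"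
      using j by (simp add: matrix_matrix_mult_def Z_def companion_def)
    also have "\<dots> = - (\<Sum>k<CARD('n). fps_X ^ k * fps_const (coeff p k))"
      by (subst sum_idx[of "\<lambda>k. fps_X ^ k * fps_const (- coeff p k)"])
        (simp add: fps_const_neg[symmetric] sum_negf del: fps_const_neg)
    also have "\<dots> = fps_X ^ (idx j - 1) * fps_X - fps_of_poly p"
      using j idx_range(1)[of j] monic_fps_of_poly[OF assms(1,2)]
      by (simp add: power_Suc2[symmetric] del: power_Suc)
    finally show ?thesis
      using j by (simp add: Z_def adj_def e_col_def)
  qed
  then show ?thesis
    by (simp add: vec_eq_iff matrix_sub_ldistrib mat_matrix_mult_nth matrix_mat_mult_nth)
qed


section \<open>Stein equations\<close>

lemma linear_adj: "linear (adj :: quat^'n^'m \<Rightarrow> quat^'m^'n)"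
  by (rule linearI) (simp add: adj_add, simp add: vec_eq_iff adj_def)

lemma entry_adj_mult_self: "entry (adj M ** M) = of_real ((norm (entry M))\<^sup>2)"
  and entry_mult_adj_self: "entry (M ** adj M) = of_real ((norm (entry M))\<^sup>2)"
  for M :: "quat^1^1"
  by (simp_all only: entry_mult entry_adj mult_qcnj_norm qcnj_mult_norm)

lemma summable_norm_matrix_mult:
  fixes M :: "nat \<Rightarrow> quat^'p^'n" and X :: "quat^'n^'m" and Y :: "quat^'q^'p"
  assumes "\<And>i j. summable (\<lambda>k. norm (M k $ i $ j))"
  shows "summable (\<lambda>k. norm ((X ** M k ** Y) $ i $ j))"
proof (rule summable_comparison_test')
  show "summable (\<lambda>k. \<Sum>b\<in>UNIV. \<Sum>a\<in>UNIV. norm (X $ i $ a) * norm (M k $ a $ b) * norm (Y $ b $ j))"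
    by (intro summable_sum summable_mult summable_mult2 assms)
  show "norm (norm ((X ** M k ** Y) $ i $ j)) \<le>
      (\<Sum>b\<in>UNIV. \<Sum>a\<in>UNIV. norm (X $ i $ a) * norm (M k $ a $ b) * norm (Y $ b $ j))" for k
    unfolding matrix_matrix_mult_def
    by (auto simp: sum_distrib_right norm_mult intro!: sum_norm_le)
qed

lemma gramian_term_eq: "gramian_term A v k = (mat_power A k ** v) ** adj (mat_power A k ** v)"
  by (simp add: gramian_term_def adj_mult adj_mat_power matrix_mul_assoc)

lemma gramian_term_Suc: "gramian_term A v (Suc k) = A ** gramian_term A v k ** adj A"
  by (simp add: gramian_term_eq adj_mult matrix_mul_assoc)

text \<open>Stability is put as absolute summability of the powers, the form in which the recursion
  delivers it and the series use it.\<close>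

locale stable_controllable =
  fixes A :: "quat^'n::{finite,linorder}^'n::{finite,linorder}" and v :: "quat^1^'n::{finite,linorder}"
  assumes summable_power: "summable (\<lambda>k. norm (mat_power A k $ i $ j))"
    and controllable: "invertible (controllability A v)"
begin

abbreviation "P \<equiv> gramian A v"
abbreviation "g \<equiv> g_col A v"

lemma summable_gramian_term: "summable (gramian_term A v)"
proof (intro summable_vec)
  fix i j
  have l1: "Abs_fps (\<lambda>k. (mat_power A k ** v) $ i $ 1) \<in> l1" for i
    using summable_norm_matrix_mult[of "mat_power A" "mat 1" v i 1, OF summable_power] by (simp add: l1_def)
  have "summable (\<lambda>k. norm ((mat_power A k ** v) $ i $ 1) * norm ((mat_power A k ** v) $ j $ 1))"
    using summable_mult_l1[OF l1 l1] by simp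
  then have "summable (\<lambda>k. norm (gramian_term A v k $ i $ j))"
    by (simp add: gramian_term_eq matrix_matrix_mult_def[of "_ ** v"] adj_def norm_mult)
  then show "summable (\<lambda>k. gramian_term A v k $ i $ j)"
    by (rule summable_norm_cancel)
qed

lemma mat_power_tendsto_0: "mat_power A \<longlonglongrightarrow> 0"
  by (intro vec_tendstoI)
    (simp add: summable_LIMSEQ_zero[OF summable_norm_cancel[OF summable_power]])

lemma adj_power_tendsto_0: "mat_power (adj A) \<longlonglongrightarrow> 0"
  using tendsto_adj[OF mat_power_tendsto_0] by (simp only: adj_mat_power adj_0)

text \<open>An eigenvector satisfies A^k x = x \<alpha>^k, and the powers of A tend to 0.\<close>

lemma spectrum_subset: "right_spectrum A \<subseteq> \<bbbB>\<^sub>1"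
proof
  fix \<alpha>
  assume "\<alpha> \<in> right_spectrum A"
  then obtain x :: "quat^1^'n::{finite,linorder}" where x: "x \<noteq> 0" "A ** x = x ** mat \<alpha>"
    by (auto simp: right_spectrum_def)
  obtain i where i: "x $ i $ 1 \<noteq> 0"
    using x(1) by (auto simp: vec_eq_iff)
  have Ax: "(mat_power A k ** x) $ i $ 1 = x $ i $ 1 * \<alpha> ^ k" for i k
  proof (induction k arbitrary: i)
    case (Suc k)
    have "mat_power A (Suc k) ** x = mat_power A k ** x ** mat \<alpha>"
      using x(2) by (simp only: mat_power.simps mat_power_commute[symmetric] matrix_mul_assoc[symmetric])
    then show ?case
      using Suc by (simp add: matrix_mat_mult_nth mult.assoc power_commutes)
  qed simp
  have "(\<lambda>k. (mat_power A k ** x) $ i $ 1) \<longlonglongrightarrow> (0 ** x) $ i $ 1"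
    by (intro tendsto_vec_nth tendsto_matrix_mult mat_power_tendsto_0 tendsto_const)
  then have "(\<lambda>k. inverse (x $ i $ 1) * (x $ i $ 1 * \<alpha> ^ k)) \<longlonglongrightarrow> inverse (x $ i $ 1) * 0"
    unfolding Ax by (intro tendsto_mult tendsto_const) simp
  then have "(\<lambda>k. \<alpha> ^ k) \<longlonglongrightarrow> 0"
    using i by (simp add: mult.assoc[symmetric])
  then have "(\<lambda>k. norm \<alpha> ^ k) \<longlonglongrightarrow> 0"
    using tendsto_norm_zero by (force simp: norm_power)
  then have "\<not> 1 \<le> norm \<alpha>"
    using LIMSEQ_le_const[of "\<lambda>k. norm \<alpha> ^ k" 0 1] one_le_power[of "norm \<alpha>"] by auto
  then show "\<alpha> \<in> \<bbbB>\<^sub>1"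
    by simp
qed

lemma invertible_1_minus: "invertible (mat 1 - A)"
proof (rule invertible_if_injective)
  fix x :: "quat^1^'n::{finite,linorder}"
  assume "(mat 1 - A) ** x = 0"
  then have "A ** x = x ** mat 1"
    by (simp add: matrix_sub_rdistrib)
  show "x = 0"
  proof (rule ccontr)
    assume "x \<noteq> 0"
    then have "1 \<in> right_spectrum A"
      using \<open>A ** x = x ** mat 1\<close> by (auto simp: right_spectrum_def)
    from subsetD[OF spectrum_subset this] show False
      by simp
  qed
qed

lemma stein: "P = A ** P ** adj A + v ** adj v"
proof -
  have "A ** P ** adj A = (\<Sum>k. gramian_term A v (Suc k))"
    unfolding gramian_def gramian_term_Suc
    by (rule bounded_linear.suminf[OF bounded_linear_matrix_mult summable_gramian_term])
  also have "\<dots> = P - gramian_term A v 0"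
    unfolding gramian_def by (rule suminf_split_head[OF summable_gramian_term])
  finally show ?thesis
    by (simp add: gramian_term_eq)
qed

lemma adj_gramian: "adj P = P"
proof -
  have "adj P = (\<Sum>k. adj (gramian_term A v k))"
    unfolding gramian_def
    using linear_adj by (intro bounded_linear.suminf[OF _ summable_gramian_term])
      (simp add: linear_conv_bounded_linear)
  then show ?thesis
    by (simp add: gramian_def gramian_term_eq adj_mult)
qed

text \<open>The form \<open>adj x ** P ** x\<close> is a sum of squares. If it vanishes, so do the
  terms for k below n, which are the entries of
  \<open>adj (controllability A v) ** x\<close>.\<close>

lemma invertible_gramian: "invertible P"
proof (rule invertible_if_injective)
  fix x :: "quat^1^'n::{finite,linorder}"
  assume "P ** x = 0"
  define y where "y k = adj (mat_power A k ** v) ** x" for k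
  have "bounded_linear (\<lambda>M. entry (adj x ** M ** x))"
    by (rule bounded_linear_compose[OF bounded_linear_entry bounded_linear_matrix_mult])
  then have "(\<lambda>k. entry (adj x ** gramian_term A v k ** x)) sums entry (adj x ** P ** x)"
    using summable_sums[OF summable_gramian_term] unfolding gramian_def by (rule bounded_linear.sums)
  moreover have "entry (adj x ** gramian_term A v k ** x) = of_real ((norm (entry (y k)))\<^sup>2)" for k
    unfolding entry_adj_mult_self[symmetric] y_def gramian_term_eq adj_mult adj_adj
    by (simp only: matrix_mul_assoc)
  moreover have "entry (adj x ** P ** x) = 0"
    using \<open>P ** x = 0\<close> by (simp add: matrix_mul_assoc[symmetric])
  ultimately have "(\<lambda>k. of_real ((norm (entry (y k)))\<^sup>2) :: quat) sums of_real 0"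
    by simp
  then have "(\<lambda>k. (norm (entry (y k)))\<^sup>2) sums 0"
    unfolding sums_of_real_iff .
  then have y: "entry (y k) = 0" for k
    using suminf_eq_zero_iff[of "\<lambda>k. (norm (entry (y k)))\<^sup>2"] by (simp add: sums_iff)
  have "(adj (controllability A v) ** x) $ i $ 1 = entry (y (idx i - 1))" for i
    unfolding y_def by (simp add: matrix_matrix_mult_def[of _ x] adj_def controllability_def)
  then have "adj (controllability A v) ** x = 0"
    by (simp add: vec_eq_iff y)
  then have "matrix_inv (adj (controllability A v)) ** (adj (controllability A v) ** x) = 0"
    by simp
  then show "x = 0"
    by (simp add: matrix_mul_assoc matrix_inv invertible_adj controllable)
qed

lemma invertible_1_minus_adj: "invertible (mat 1 - adj A)"
  using invertible_adj[OF invertible_1_minus] by (simp add: adj_diff)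

section \<open>The dual Stein equation and telescoping sums\<close>

abbreviation "P_inv \<equiv> matrix_inv P"
abbreviation "A_inv \<equiv> matrix_inv (mat 1 - A)"
abbreviation "A_inv' \<equiv> matrix_inv (mat 1 - adj A)"

lemma cancel:
  fixes M :: "quat^'m^'n::{finite,linorder}"
  shows "P ** (P_inv ** M) = M" "P_inv ** (P ** M) = M"
    "(mat 1 - A) ** (A_inv ** M) = M" "A_inv ** ((mat 1 - A) ** M) = M"
    "(mat 1 - adj A) ** (A_inv' ** M) = M" "A_inv' ** ((mat 1 - adj A) ** M) = M"
  by (simp_all add: matrix_mul_assoc matrix_inv invertible_gramian invertible_1_minus invertible_1_minus_adj)

lemma g_eq: "g = (mat 1 - adj A) ** (P_inv ** (A_inv ** v))"
  by (simp add: g_col_def matrix_mul_assoc)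

lemma adj_P_inv: "adj P_inv = P_inv"
  by (simp add: adj_matrix_inv invertible_gramian adj_gramian)

lemma adj_A_inv: "adj A_inv = A_inv'"
  by (simp add: adj_matrix_inv invertible_1_minus adj_diff)

text \<open>The Stein equation is multiplied by \<open>A_inv\<close> and \<open>A_inv'\<close> on
  its two sides, then by the remaining outer factors of \<open>g\<close> and
  \<open>adj g\<close>.\<close>

lemma dual_stein: "g ** adj g = P_inv - adj A ** P_inv ** A"
proof -
  have "v ** adj v = P - A ** (P ** adj A)"
    by (metis stein add_diff_cancel_left' matrix_mul_assoc)
  \<comment> \<open>Each summand now contains one of the two factors about to be inverted, on the
    matching side.\<close>
  also have "\<dots> = (mat 1 - A) ** P + A ** P ** (mat 1 - adj A)"
    by (simp add: matrix_sub_ldistrib matrix_sub_rdistrib matrix_mul_assoc)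
  finally have "A_inv ** (v ** adj v) ** A_inv' = A_inv ** ((mat 1 - A) ** P + A ** P ** (mat 1 - adj A)) ** A_inv'"
    by simp
  also have "\<dots> = A_inv ** ((mat 1 - A) ** P) ** A_inv' + A_inv ** A ** P ** ((mat 1 - adj A) ** A_inv')"
    by (simp only: matrix_add_ldistrib matrix_add_rdistrib matrix_mul_assoc)
  also have "\<dots> = P ** A_inv' + A_inv ** A ** P"
    by (simp only: cancel matrix_inv[OF invertible_1_minus_adj] matrix_mul_rid)
  finally have vv: "A_inv ** (v ** adj v) ** A_inv' = P ** A_inv' + A_inv ** A ** P" .
  have comm: "A_inv ** A ** (mat 1 - A) = A"
  proof -
    have "A ** (mat 1 - A) = (mat 1 - A) ** A"
      by (simp add: matrix_sub_ldistrib matrix_sub_rdistrib)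
    then show ?thesis
      by (simp only: matrix_mul_assoc[symmetric] cancel)
  qed
  have "g ** adj g = (mat 1 - adj A) ** P_inv ** (A_inv ** (v ** adj v) ** A_inv') ** P_inv ** (mat 1 - A)"
    by (simp only: g_eq adj_mult adj_P_inv adj_A_inv adj_diff adj_mat_1 adj_adj matrix_mul_assoc)
  also have "\<dots> = (mat 1 - adj A) ** (P_inv ** (P ** (A_inv' ** (P_inv ** (mat 1 - A))))) +
      (mat 1 - adj A) ** P_inv ** (A_inv ** A ** (P ** (P_inv ** (mat 1 - A))))"
    unfolding vv by (simp only: matrix_add_ldistrib matrix_add_rdistrib matrix_mul_assoc)
  also have "\<dots> = P_inv ** (mat 1 - A) + (mat 1 - adj A) ** P_inv ** A"
    by (simp only: cancel comm)
  also have "\<dots> = P_inv - adj A ** P_inv ** A"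
    by (simp add: matrix_sub_ldistrib matrix_sub_rdistrib)
  finally show ?thesis .
qed

lemma row_norm_sums:
  fixes r :: "quat^'n::{finite,linorder}^1"
  shows "(\<lambda>k. of_real ((norm (entry (r ** mat_power (adj A) k ** g)))\<^sup>2)) sums entry (r ** P_inv ** adj r)"
proof -
  define E where "E k = entry (r ** mat_power (adj A) k ** P_inv ** mat_power A k ** adj r)" for k
  have "of_real ((norm (entry (r ** mat_power (adj A) k ** g)))\<^sup>2) = E k - E (Suc k)" for k
  proof -
    have "(r ** mat_power (adj A) k ** g) ** adj (r ** mat_power (adj A) k ** g) =
        r ** mat_power (adj A) k ** (g ** adj g) ** mat_power A k ** adj r"
      by (simp only: adj_mult adj_mat_power adj_adj matrix_mul_assoc)
    also have "\<dots> = r ** mat_power (adj A) k ** P_inv ** mat_power A k ** adj r -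
        r ** (mat_power (adj A) k ** adj A) ** P_inv ** (A ** mat_power A k) ** adj r"
      unfolding dual_stein by (simp only: matrix_sub_ldistrib matrix_sub_rdistrib matrix_mul_assoc)
    finally show ?thesis
      unfolding entry_mult_adj_self[symmetric] E_def mat_power_commute mat_power.simps by simp
  qed
  moreover have "E \<longlonglongrightarrow> entry (r ** 0 ** P_inv ** 0 ** adj r)"
    unfolding E_def
    by (intro tendsto_vec_nth tendsto_matrix_mult tendsto_const adj_power_tendsto_0 mat_power_tendsto_0)
  ultimately have "(\<lambda>k. of_real ((norm (entry (r ** mat_power (adj A) k ** g)))\<^sup>2)) sums (E 0 - 0)"
    using telescope_sums'[of E 0] by simp
  then show ?thesis
    by (simp add: E_def)
qed

lemma row_l1: "Abs_fps (\<lambda>k. entry (r ** mat_power (adj A) k ** c)) \<in> l1"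
proof -
  have "summable (\<lambda>k. norm (mat_power (adj A) k $ i $ j))" for i j
    using summable_power[of j i] by (subst adj_mat_power[symmetric]) (simp add: adj_def)
  from summable_norm_matrix_mult[OF this, where i = 1 and j = 1] show ?thesis
    by (simp add: l1_def)
qed

text \<open>As \<open>g\<close> has the form x - \<open>adj A ** x\<close>, the terms telescope. The
  sum is the constant subtracted in Theta, which is what gives Theta the value 1 at z = 1.\<close>

lemma output_sums: "(\<lambda>k. entry (adj v ** mat_power (adj A) k ** g)) sums entry (adj v ** A_inv' ** g)"
proof -
  define x where "x = A_inv' ** g"
  define E where "E k = entry (adj v ** mat_power (adj A) k ** x)" for k
  have "g = x - adj A ** x"
    using cancel(5)[of g] by (simp add: x_def matrix_sub_rdistrib)
  then have "entry (adj v ** mat_power (adj A) k ** g) = E k - E (Suc k)" for k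
    unfolding E_def mat_power.simps mat_power_commute[symmetric]
    by (simp only: matrix_sub_ldistrib matrix_mul_assoc vector_minus_component)
  moreover have "E \<longlonglongrightarrow> entry (adj v ** 0 ** x)"
    unfolding E_def
    by (intro tendsto_vec_nth tendsto_matrix_mult tendsto_const adj_power_tendsto_0)
  ultimately have "(\<lambda>k. entry (adj v ** mat_power (adj A) k ** g)) sums (E 0 - 0)"
    using telescope_sums'[of E 0] by simp
  then show ?thesis
    by (simp add: E_def x_def matrix_mul_assoc)
qed

end


section \<open>The function of a pair similar to a companion pair\<close>

text \<open>The backward shift is the adjoint of multiplication by z; it drops the constant term of
  Theta, whose other coefficients obey the recursion.\<close>

lemma ip_mult_X_right:
  assumes "f \<in> l1" "g \<in> l1"
  shows "ip f (fps_X * g) = ip (Abs_fps (\<lambda>k. fps_nth f (Suc k))) g"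
proof -
  have "Abs_fps (\<lambda>k. fps_nth f (Suc k)) \<in> l1"
    using assms(1) unfolding l1_def fps_nth_Abs_fps mem_Collect_eq by (subst summable_Suc_iff)
  from ip_sums[OF this assms(2)]
  have "(\<lambda>k. qcnj (fps_nth (fps_X * g) (Suc k)) * fps_nth f (Suc k)) sums ip (Abs_fps (\<lambda>k. fps_nth f (Suc k))) g"
    by simp
  from sums_Suc[OF this] ip_sums[OF assms(1) l1_mult[OF l1_X assms(2)]] show ?thesis
    by (simp add: sums_unique2)
qed

locale companion_similar =
  fixes p :: "quat poly"
    and A T :: "quat^'n::{finite,linorder}^'n::{finite,linorder}"
    and v :: "quat^1^'n::{finite,linorder}"
  assumes degree: "degree p = CARD('n)" and lead: "lead_coeff p = 1"
    and right_zeros: "right_zero (fps_of_poly p) \<gamma> \<Longrightarrow> norm \<gamma> < 1"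
    and T: "invertible T" and A: "A = T ** companion p ** matrix_inv T" and v: "v = T ** e_col 1"
begin

lemma power_mult_T: "mat_power A k ** T = T ** mat_power (companion p) k"
proof (induction k)
  case (Suc k)
  have "A ** T = T ** companion p"
    by (simp add: A matrix_mul_assoc[symmetric] matrix_inv T)
  then show ?case
    using Suc by (metis mat_power.simps(2) matrix_mul_assoc)
qed simp

lemma power_mult_v: "mat_power A k ** v = T ** (mat_power (companion p) k ** e_col 1)"
  by (simp only: v matrix_mul_assoc power_mult_T)

text \<open>The companion pair generates the unit columns in order, and \<open>T\<close> carries
  them to the columns A^k v.\<close>

lemma controllability_eq: "controllability A v = T"
proof -
  have "(mat_power A (idx j - 1) ** v) $ i $ 1 = T $ i $ j" for i j
  proof -
    have "idx j - 1 < CARD('n)" "Suc (idx j - 1) = idx j"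
      using idx_range[of j] by linarith+
    then have "mat_power A (idx j - 1) ** v = T ** e_col (idx j)"
      using companion_power_e_col[of "idx j - 1" p, where 'n = 'n] by (simp only: power_mult_v)
    then show ?thesis
      by (simp only: matrix_mult_e_col_nth)
  qed
  then show ?thesis
    by (simp add: controllability_def vec_eq_iff)
qed

lemma inv_T_power_card: "matrix_inv T ** mat_power A CARD('n) ** v = (\<chi> i _. - coeff p (idx i - 1))"
proof -
  have "matrix_inv T ** mat_power A CARD('n) ** v = (matrix_inv T ** T) ** (mat_power (companion p) CARD('n) ** e_col 1)"
    by (simp only: matrix_mul_assoc[symmetric] power_mult_v)
  then show ?thesis
    by (simp only: matrix_inv T matrix_mul_lid companion_power_card_e_col)
qed

text \<open>For j = 0 this is the last column of the companion matrix. The coefficients stand on the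
  right, so multiplying by A^j on the left preserves the relation.\<close>

lemma recursion: "(\<Sum>i\<le>CARD('n). (mat_power A (i + j) ** v) $ m $ 1 * coeff p i) = 0"
proof -
  have base: "(\<Sum>i\<le>CARD('n). (mat_power A i ** v) $ m $ 1 * coeff p i) = 0" for m
  proof -
    have "(mat_power A CARD('n) ** v) $ m $ 1 = (\<Sum>l\<in>UNIV. T $ m $ l * - coeff p (idx l - 1))"
      unfolding power_mult_v companion_power_card_e_col by (simp add: matrix_matrix_mult_def)
    also have "\<dots> = (\<Sum>l\<in>UNIV. controllability A v $ m $ l * - coeff p (idx l - 1))"
      by (simp only: controllability_eq)
    also have "\<dots> = (\<Sum>l::'n\<in>UNIV. (mat_power A (idx l - 1) ** v) $ m $ 1 * - coeff p (idx l - 1))"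
      by (simp add: controllability_def)
    also have "\<dots> = (\<Sum>i<CARD('n). (mat_power A i ** v) $ m $ 1 * - coeff p i)"
      by (rule sum_idx)
    finally have "(mat_power A CARD('n) ** v) $ m $ 1 = - (\<Sum>i<CARD('n). (mat_power A i ** v) $ m $ 1 * coeff p i)"
      by (simp add: sum_negf)
    moreover have "coeff p CARD('n) = 1"
      using degree lead by simp
    ultimately show ?thesis
      by (simp add: lessThan_Suc_atMost[symmetric])
  qed
  have "(mat_power A (i + j) ** v) $ m $ 1 = (\<Sum>l\<in>UNIV. mat_power A j $ m $ l * (mat_power A i ** v) $ l $ 1)" for i
  proof -
    have "mat_power A (i + j) ** v = mat_power A j ** (mat_power A i ** v)"
      by (simp only: add.commute[of i j] mat_power_add matrix_mul_assoc)
    then show ?thesis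
      by (simp only: matrix_matrix_mult_def[of "mat_power A j"] vec_lambda_beta)
  qed
  then have "(\<Sum>i\<le>CARD('n). (mat_power A (i + j) ** v) $ m $ 1 * coeff p i) =
      (\<Sum>l\<in>UNIV. mat_power A j $ m $ l * (\<Sum>i\<le>CARD('n). (mat_power A i ** v) $ l $ 1 * coeff p i))"
    by (simp add: sum_distrib_right sum_distrib_left mult.assoc) (rule sum.swap)
  then show ?thesis
    by (simp add: base)
qed

lemma row_recursion:
  "(\<Sum>i\<le>CARD('n). entry (r ** mat_power A (i + j) ** v) * coeff p i) = 0"
proof -
  have "entry (r ** mat_power A k ** v) = (\<Sum>m\<in>UNIV. r $ 1 $ m * (mat_power A k ** v) $ m $ 1)" for k
    by (simp only: matrix_mul_assoc[symmetric]) (simp only: matrix_matrix_mult_def[of r] vec_lambda_beta)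
  then have "(\<Sum>i\<le>CARD('n). entry (r ** mat_power A (i + j) ** v) * coeff p i) =
      (\<Sum>m\<in>UNIV. r $ 1 $ m * (\<Sum>i\<le>CARD('n). (mat_power A (i + j) ** v) $ m $ 1 * coeff p i))"
    by (simp add: sum_distrib_right sum_distrib_left mult.assoc) (rule sum.swap)
  then show ?thesis
    by (simp add: recursion)
qed

lemma linear_factors:
  obtains \<alpha>s where "length \<alpha>s = CARD('n)" "set \<alpha>s \<subseteq> \<bbbB>\<^sub>1"
    "fps_of_poly p = prod_list (map (\<lambda>\<alpha>. fps_X - fps_const \<alpha>) \<alpha>s)"
proof -
  have "norm \<gamma> < 1" if "(\<Sum>k\<le>CARD('n). coeff p k * \<gamma> ^ k) = 0" for \<gamma>
  proof (rule right_zeros)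
    have "right_value (fps_of_poly p) \<gamma> = (\<Sum>k\<le>CARD('n). coeff p k * \<gamma> ^ k)"
      unfolding right_value_def fps_of_poly_nth
      by (rule suminf_finite) (use degree in \<open>auto simp: coeff_eq_0\<close>)
    then show "right_zero (fps_of_poly p) \<gamma>"
      using that by (simp add: right_zero_def)
  qed
  then show ?thesis
    using monic_factorization[of "CARD('n)" "fps_of_poly p"] degree lead that by (auto simp: coeff_eq_0)
qed

text \<open>The columns of A^k T are A^(k+j) v for j below n, so every entry follows the recursion
  of p and is absolutely summable in k; multiplying by the inverse of \<open>T\<close> returns to
  A^k.\<close>

sublocale stable_controllable A v
proof
  show "invertible (controllability A v)"
    by (simp add: controllability_eq T)
  obtain \<alpha>s where \<alpha>s: "length \<alpha>s = CARD('n)" "set \<alpha>s \<subseteq> \<bbbB>\<^sub>1"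
    "fps_of_poly p = prod_list (map (\<lambda>\<alpha>. fps_X - fps_const \<alpha>) \<alpha>s)"
    by (rule linear_factors)
  have "summable (\<lambda>k. norm ((mat_power A k ** T) $ i $ j))" for i j
  proof -
    define u where "u k = (mat_power A (k + (idx j - 1)) ** v) $ i $ 1" for k
    have "Abs_fps u \<in> l1"
    proof (rule linear_recursion_l1[OF \<alpha>s(2)])
      fix l
      show "(\<Sum>k\<le>length \<alpha>s. u (k + l) * fps_nth (prod_list (map (\<lambda>\<alpha>. fps_X - fps_const \<alpha>) \<alpha>s)) k) = 0"
        unfolding u_def \<alpha>s(1) \<alpha>s(3)[symmetric] fps_of_poly_nth add.assoc by (rule recursion)
    qed
    moreover have "(mat_power A k ** T) $ i $ j = u k" for k
    proof -
      have "(mat_power A k ** T) $ i $ j = (mat_power A k ** (mat_power A (idx j - 1) ** v)) $ i $ 1"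
        unfolding controllability_eq[symmetric] controllability_def
        by (simp add: matrix_matrix_mult_def[of "mat_power A k"])
      then show ?thesis
        by (simp only: u_def mat_power_add matrix_mul_assoc)
    qed
    ultimately show ?thesis
      by (simp add: l1_def)
  qed
  from summable_norm_matrix_mult[of "\<lambda>k. mat_power A k ** T" "mat 1" "matrix_inv T", OF this]
  show "summable (\<lambda>k. norm (mat_power A k $ i $ j))" for i j
    by (simp add: matrix_mul_assoc[symmetric] matrix_inv T)
qed

section \<open>The explicit formula for Theta\<close>

lemma fps_of_poly_eq:
  "fps_of_poly p = fps_X ^ CARD('n) - entry ((\<chi> _ j. fps_X ^ (idx j - 1)) **
     const_mat (matrix_inv (controllability A v) ** mat_power A CARD('n) ** v))"
proof -
  have "entry ((\<chi> _ j. fps_X ^ (idx j - 1)) **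
     const_mat (matrix_inv (controllability A v) ** mat_power A CARD('n) ** v)) =
     (\<Sum>k<CARD('n). fps_X ^ k * fps_const (- coeff p k))"
    unfolding controllability_eq inv_T_power_card row_idx_mult_const_mat[of "\<lambda>k. - coeff p k"]
    by (simp add: mat_def)
  also have "\<dots> = - (\<Sum>k<CARD('n). fps_X ^ k * fps_const (coeff p k))"
    by (simp add: fps_const_neg[symmetric] sum_negf del: fps_const_neg)
  finally show ?thesis
    by (simp add: monic_fps_of_poly[OF degree lead])
qed

lemma R_series_eq:
  "R_series A v = Abs_fps (\<lambda>k. entry (adj (e_col CARD('n)) ** matrix_inv (controllability A v) ** P
     ** mat_power (adj A) k ** g))"
  unfolding R_series_def by (rule entry_resolvent)

text \<open>The companion identity carried over to A by \<open>T\<close>. The second part holds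
  because the inverse of \<open>T\<close> maps v to e_1 and \<open>Z\<close> starts with 1.\<close>

lemma poly_row:
  defines "Z \<equiv> \<chi> _ j. fps_X ^ (idx j - 1) :: quat fps^'n::{finite,linorder}^1"
  shows "mat (fps_of_poly p) ** const_mat (adj (e_col CARD('n) :: quat^1^'n::{finite,linorder}) ** matrix_inv T) =
    Z ** const_mat (matrix_inv T) ** (mat fps_X - const_mat A)"
    and "Z ** const_mat (matrix_inv T) ** const_mat v = mat 1"
proof -
  have TA: "companion p ** matrix_inv T = matrix_inv T ** A"
    by (simp add: A matrix_mul_assoc matrix_inv T)
  have "mat (fps_of_poly p) ** const_mat (adj (e_col CARD('n) :: quat^1^'n::{finite,linorder}) ** matrix_inv T) =
      Z ** ((mat fps_X - const_mat (companion p)) ** const_mat (matrix_inv T))"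
    unfolding const_mat_mult matrix_mul_assoc Z_def row_mult_companion[OF degree lead] ..
  also have "(mat fps_X - const_mat (companion p)) ** const_mat (matrix_inv T) =
      const_mat (matrix_inv T) ** (mat fps_X - const_mat A)"
    unfolding matrix_sub_rdistrib matrix_sub_ldistrib const_mat_mult[symmetric] TA mat_fps_X_commute ..
  finally show "mat (fps_of_poly p) ** const_mat (adj (e_col CARD('n) :: quat^1^'n::{finite,linorder}) ** matrix_inv T) =
    Z ** const_mat (matrix_inv T) ** (mat fps_X - const_mat A)"
    by (simp only: matrix_mul_assoc)
  have "matrix_inv T ** v = e_col 1"
    by (simp add: v matrix_mul_assoc matrix_inv T)
  also have "\<dots> = (\<chi> i _. if idx i - 1 = 0 then 1 else 0)"
    using idx_range(1)[where 'n = 'n] by (simp add: e_col_def vec_eq_iff le_antisym)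
  finally have "Z ** const_mat (matrix_inv T ** v) =
      mat (\<Sum>k<CARD('n). fps_X ^ k * fps_const (if k = 0 then 1 else 0))"
    unfolding Z_def by (simp only: row_idx_mult_const_mat[of "\<lambda>k. if k = 0 then 1 else 0"])
  also have "(\<Sum>k<CARD('n). fps_X ^ k * fps_const (if k = 0 then 1 else 0)) = (1 :: quat fps)"
    by (simp add: if_distrib[of fps_const] mult_delta_right cong: if_cong)
  finally show "Z ** const_mat (matrix_inv T) ** const_mat v = mat 1"
    by (simp only: const_mat_mult matrix_mul_assoc)
qed

text \<open>Replacing z P by the Stein equation gives (z - A) P = z v \<open>adj v\<close> - A P (1
  - z \<open>adj A\<close>), and the resolvent cancels the last factor.\<close>

lemma stein_resolvent:
  "(mat fps_X - const_mat A) ** const_mat P ** resolvent (adj A) =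
   mat fps_X ** const_mat (v ** adj v) ** resolvent (adj A) - const_mat (A ** P)"
proof -
  have comm: "const_mat (A ** P) ** (mat fps_X ** const_mat (adj A)) = mat fps_X ** const_mat (A ** P ** adj A)"
    by (simp only: matrix_mul_assoc const_mat_mult[of "A ** P"] mat_fps_X_commute[of "const_mat (A ** P)"])
  have "const_mat P = const_mat (A ** P ** adj A) + const_mat (v ** adj v)"
    using stein const_mat_add by metis
  then have "mat fps_X ** const_mat P =
      mat fps_X ** const_mat (A ** P ** adj A) + mat fps_X ** const_mat (v ** adj v)"
    by (simp only: matrix_add_ldistrib)
  then have "(mat fps_X - const_mat A) ** const_mat P =
      mat fps_X ** const_mat (A ** P ** adj A) + mat fps_X ** const_mat (v ** adj v) - const_mat (A ** P)"
    by (simp only: matrix_sub_rdistrib const_mat_mult)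
  also have "\<dots> = mat fps_X ** const_mat (v ** adj v) -
      const_mat (A ** P) ** (mat 1 - mat fps_X ** const_mat (adj A))"
    by (simp only: matrix_sub_ldistrib matrix_mul_rid comm) simp
  finally have "(mat fps_X - const_mat A) ** const_mat P =
      mat fps_X ** const_mat (v ** adj v) - const_mat (A ** P) ** (mat 1 - mat fps_X ** const_mat (adj A))" .
  then have "(mat fps_X - const_mat A) ** const_mat P ** resolvent (adj A) =
      mat fps_X ** const_mat (v ** adj v) ** resolvent (adj A) -
      const_mat (A ** P) ** ((mat 1 - mat fps_X ** const_mat (adj A)) ** resolvent (adj A))"
    by (simp only: matrix_sub_rdistrib[of "mat fps_X ** const_mat (v ** adj v)"] matrix_mul_assoc)
  then show ?thesis
    by (simp only: resolvent_mult matrix_mul_rid)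
qed

text \<open>The leading factor of \<open>g\<close> completes A P to
  \<open>A ** P ** (mat 1 - adj A)\<close>, which the Stein equation evaluates; the part with
  \<open>P\<close> collapses to v. This produces the constant term of Theta.\<close>

lemma state_g: "A ** P ** g = v ** (adj v ** A_inv' ** g) - v"
proof -
  have "A ** P ** (mat 1 - adj A) = v ** adj v - (mat 1 - A) ** P"
    using stein by (simp add: matrix_sub_ldistrib matrix_sub_rdistrib algebra_simps)
  then have "A ** P ** g = (v ** adj v - (mat 1 - A) ** P) ** (P_inv ** (A_inv ** v))"
    by (simp only: g_eq matrix_mul_assoc)
  also have "\<dots> = v ** (adj v ** (P_inv ** (A_inv ** v))) - (mat 1 - A) ** (P ** (P_inv ** (A_inv ** v)))"
    unfolding matrix_sub_rdistrib[of "v ** adj v"] by (simp only: matrix_mul_assoc)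
  finally show ?thesis
    by (simp only: cancel g_eq matrix_mul_assoc[symmetric])
qed

lemma Theta_eq:
  "fps_of_poly p * R_series A v = fps_const (1 - entry (adj v ** A_inv' ** g)) +
     fps_X * entry (const_mat (adj v) ** resolvent (adj A) ** const_mat g)"
proof -
  define Z where "Z = (\<chi> _ j. fps_X ^ (idx j - 1) :: quat fps^'n::{finite,linorder}^1)"
  \<comment> \<open>p times the row of R becomes \<open>Y\<close> times z - A. All surviving terms
    begin with v, and \<open>Y\<close> maps v to 1.\<close>
  define Y where "Y = Z ** const_mat (matrix_inv T)"
  define V where "V = const_mat (adj v) ** resolvent (adj A) ** const_mat g"
  have Yv: "Y ** const_mat v = mat 1"
    unfolding Y_def Z_def by (rule poly_row)
  have "mat (fps_of_poly p) ** (const_mat (adj (e_col CARD('n)) ** matrix_inv T ** P) ** resolvent (adj A) ** const_mat g) =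
      mat (fps_of_poly p) ** const_mat (adj (e_col CARD('n)) ** matrix_inv T) ** const_mat P ** resolvent (adj A) ** const_mat g"
    by (simp only: const_mat_mult matrix_mul_assoc)
  also have "\<dots> = Y ** ((mat fps_X - const_mat A) ** const_mat P ** resolvent (adj A)) ** const_mat g"
    unfolding poly_row Y_def Z_def by (simp only: matrix_mul_assoc)
  also have "\<dots> = Y ** (mat fps_X ** const_mat (v ** adj v) ** resolvent (adj A)) ** const_mat g - Y ** const_mat (A ** P ** g)"
    unfolding stein_resolvent unfolding matrix_sub_ldistrib matrix_sub_rdistrib
    by (simp only: const_mat_mult matrix_mul_assoc)
  also have "Y ** (mat fps_X ** const_mat (v ** adj v) ** resolvent (adj A)) ** const_mat g = (Y ** mat fps_X) ** const_mat v ** V"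
    by (simp only: const_mat_mult V_def matrix_mul_assoc)
  also have "\<dots> = mat fps_X ** ((Y ** const_mat v) ** V)"
    by (simp only: mat_fps_X_commute[symmetric, of Y] matrix_mul_assoc)
  also have "Y ** const_mat (A ** P ** g) = (Y ** const_mat v) ** const_mat (adj v ** A_inv' ** g) - Y ** const_mat v"
    unfolding state_g const_mat_diff const_mat_mult[of v] matrix_sub_ldistrib by (simp only: matrix_mul_assoc)
  finally have "entry (mat (fps_of_poly p) ** (const_mat (adj (e_col CARD('n)) ** matrix_inv T ** P) ** resolvent (adj A) ** const_mat g)) =
      entry (mat fps_X ** V - (const_mat (adj v ** A_inv' ** g) - mat 1))"
    unfolding Yv matrix_mul_lid by (rule arg_cong)
  then have "fps_of_poly p * entry (const_mat (adj (e_col CARD('n)) ** matrix_inv T ** P) ** resolvent (adj A) ** const_mat g) =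
      fps_X * entry V - (fps_const (entry (adj v ** A_inv' ** g)) - 1)"
    by (simp only: mat_matrix_mult_nth vector_minus_component nth_map_matrix) (simp add: mat_def)
  moreover have "fps_const (1 - x) = 1 - fps_const x" for x :: quat
    by (simp add: fps_eq_iff)
  ultimately show ?thesis
    unfolding R_series_def controllability_eq V_def by simp
qed

lemma Theta_eq_Abs_fps:
  "fps_of_poly p * R_series A v = fps_const (1 - entry (adj v ** A_inv' ** g)) +
     Abs_fps (\<lambda>m. case m of 0 \<Rightarrow> 0 | Suc k \<Rightarrow> entry (adj v ** mat_power (adj A) k ** g))"
  unfolding Theta_eq entry_resolvent by (simp add: fps_eq_iff split: nat.split)

section \<open>Norm of R and the Blaschke product\<close>

lemma R_l1: "R_series A v \<in> l1"
  unfolding R_series_eq by (rule row_l1)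

lemma R_norm:
  "of_real ((H2_norm (R_series A v))\<^sup>2) =
     entry (adj (e_col CARD('n)) ** matrix_inv (controllability A v) ** P
       ** adj (matrix_inv (controllability A v)) ** e_col CARD('n))"
proof -
  define w where "w = adj (e_col CARD('n) :: quat^1^'n::{finite,linorder}) ** matrix_inv (controllability A v)"
  have sum: "summable (\<lambda>k. (norm (fps_nth (R_series A v) k))\<^sup>2)"
    using l1_imp_H2[OF R_l1] by (simp add: H2_def)
  have "(\<lambda>k. of_real ((norm (fps_nth (R_series A v) k))\<^sup>2)) sums entry (w ** P ** P_inv ** adj (w ** P))"
    unfolding R_series_eq fps_nth_Abs_fps w_def[symmetric] by (rule row_norm_sums)
  moreover have "(\<lambda>k. of_real ((norm (fps_nth (R_series A v) k))\<^sup>2)) sums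
      (of_real (\<Sum>k. (norm (fps_nth (R_series A v) k))\<^sup>2) :: quat)"
    using summable_sums[OF sum] by (rule sums_of_real)
  ultimately have "of_real (\<Sum>k. (norm (fps_nth (R_series A v) k))\<^sup>2) = entry (w ** P ** P_inv ** adj (w ** P))"
    by (rule sums_unique2[symmetric])
  also have "w ** P ** P_inv ** adj (w ** P) = w ** (P ** (P_inv ** (P ** adj w)))"
    by (simp only: adj_mult adj_gramian matrix_mul_assoc)
  also have "\<dots> = w ** P ** adj (matrix_inv (controllability A v)) ** e_col CARD('n)"
    by (simp only: cancel) (simp only: w_def adj_mult adj_adj matrix_mul_assoc)
  finally show ?thesis
    by (simp add: H2_norm_def w_def suminf_nonneg[OF sum])
qed

lemma R_outer:
  obtains \<beta>s s \<phi> where "set \<beta>s \<subseteq> \<bbbB>\<^sub>1" "s \<in> outer_poly" "norm \<phi> = 1"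
    "s * R_series A v = fps_const \<phi>"
    "fps_of_poly p * R_series A v = prod_list (map blaschke_factor \<beta>s) * fps_const \<phi>"
proof -
  obtain \<alpha>s where \<alpha>s: "length \<alpha>s = CARD('n)" "set \<alpha>s \<subseteq> \<bbbB>\<^sub>1"
    "fps_of_poly p = prod_list (map (\<lambda>\<alpha>. fps_X - fps_const \<alpha>) \<alpha>s)"
    by (rule linear_factors)
  obtain \<beta>s s where \<beta>s: "set \<beta>s \<subseteq> \<bbbB>\<^sub>1" and s: "s \<in> outer_poly"
    and ps: "fps_of_poly p = prod_list (map blaschke_factor \<beta>s) * s"
    using outer_poly_mult_linear_factors[OF \<alpha>s(2) outer_poly.one] unfolding \<alpha>s(3) by auto
  define B where "B = prod_list (map blaschke_factor \<beta>s)"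
  note B = blaschke_list[OF \<beta>s, folded B_def]
  obtain h where h: "h \<in> l1" "s * h = 1"
    using outer_poly_inverse[OF s] by blast
  define F \<Theta> where "F = s * R_series A v" and "\<Theta> = fps_of_poly p * R_series A v"
  have F: "F \<in> l1"
    unfolding F_def by (intro l1_mult outer_poly_l1 s R_l1)
  have \<Theta>: "\<Theta> = B * F"
    unfolding \<Theta>_def F_def ps B_def by (simp only: mult.assoc)
  then have "\<Theta> \<in> l1"
    using B(1) F by (simp add: l1_mult)
  have \<Theta>_Suc: "fps_nth \<Theta> (Suc k) = entry (adj v ** mat_power (adj A) k ** g)" for k
    unfolding \<Theta>_def Theta_eq_Abs_fps by simp
  have "fps_nth F (Suc m) = 0" for m
  proof -
    \<comment> \<open>Chosen so that p D = B z^m: the right inverse h removes s.\<close>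
    define D where "D = h * fps_X ^ m"
    have D: "D \<in> l1"
      unfolding D_def by (intro l1_mult h l1_X_power)
    have pD: "fps_of_poly p * D = B * fps_X ^ m"
      unfolding ps D_def B_def[symmetric] by (metis h(2) mult.assoc mult_1)
    \<comment> \<open>The coefficients of Theta have v on the left; conjugation puts it on the
      right, where the recursion of A^k v applies.\<close>
    define u where "u k = entry (adj g ** mat_power A k ** v)" for k
    have u: "qcnj (u k) = fps_nth \<Theta> (Suc k)" for k
      unfolding \<Theta>_Suc u_def entry_adj[symmetric] by (simp only: adj_mult adj_mat_power adj_adj matrix_mul_assoc)
    have "Abs_fps (\<lambda>k. qcnj (u k)) \<in> l1"
      unfolding u \<Theta>_Suc by (rule row_l1)
    then have u_l1: "Abs_fps u \<in> l1"
      by (simp add: l1_def)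
    have "(\<lambda>k. u k * fps_nth (prod_list (map (\<lambda>\<alpha>. fps_X - fps_const \<alpha>) \<alpha>s) * D) k) sums 0"
    proof (rule linear_recursion_sums_0[OF u_l1 D])
      fix j
      show "(\<Sum>i\<le>length \<alpha>s. u (i + j) * fps_nth (prod_list (map (\<lambda>\<alpha>. fps_X - fps_const \<alpha>) \<alpha>s)) i) = 0"
        unfolding u_def \<alpha>s(1) \<alpha>s(3)[symmetric] fps_of_poly_nth by (rule row_recursion)
    qed
    from bounded_linear.sums[OF bounded_linear_qcnj this]
    have "(\<lambda>k. qcnj (fps_nth (B * fps_X ^ m) k) * fps_nth \<Theta> (Suc k)) sums 0"
      unfolding \<alpha>s(3)[symmetric] pD qcnj_mult u by simp
    then have "ip (Abs_fps (\<lambda>k. fps_nth \<Theta> (Suc k))) (B * fps_X ^ m) = 0"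
      unfolding ip_def by (simp add: sums_iff)
    then have "ip \<Theta> (fps_X * (B * fps_X ^ m)) = 0"
      using \<open>\<Theta> \<in> l1\<close> B(1) by (simp add: ip_mult_X_right l1_mult)
    also have "fps_X * (B * fps_X ^ m) = B * fps_X ^ Suc m"
      by (metis power_Suc mult.assoc fps_mult_fps_X_commute)
    \<comment> \<open>Both arguments carry \<open>B\<close> on the left, so the isometry removes it
      and leaves a coefficient of \<open>F\<close>.\<close>
    finally have "ip F (fps_X ^ Suc m) = 0"
      unfolding \<Theta> by (simp only: B(3) F l1_X_power)
    then show ?thesis
      by (simp only: ip_X_power)
  qed
  then have const: "F = fps_const (fps_nth F 0)"
    by (auto simp: fps_eq_iff gr0_conv_Suc)
  have "(\<lambda>k. fps_nth \<Theta> (Suc k)) sums entry (adj v ** A_inv' ** g)"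
    unfolding \<Theta>_Suc by (rule output_sums)
  from sums_Suc[OF this] have "coeff_sum \<Theta> = 1"
    unfolding \<Theta>_def Theta_eq_Abs_fps by (simp add: coeff_sum_def sums_iff)
  moreover have "coeff_sum \<Theta> = coeff_sum B * fps_nth F 0"
    unfolding \<Theta> coeff_sum_mult[OF B(1) F] by (subst const) simp
  ultimately have "norm (fps_nth F 0) = 1"
    using B(2) by (metis mult_1 norm_mult norm_one)
  then show ?thesis
    using that[OF \<beta>s s] const \<Theta> unfolding F_def \<Theta>_def B_def by metis
qed

end

theorem theorem4p3:
  fixes p :: "quat poly"
    and A T :: "quat^'n::{finite,linorder}^'n::{finite,linorder}"
    and v :: "quat^1^'n::{finite,linorder}"
  assumes monic: "degree p = CARD('n)" "lead_coeff p = 1"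
    and zeros: "\<And>\<gamma>. left_zero (fps_of_poly p) \<gamma> \<or> right_zero (fps_of_poly p) \<gamma> \<Longrightarrow> \<gamma> \<in> \<bbbB>\<^sub>1"
    and similar: "invertible T" "A = T ** companion p ** matrix_inv T" "v = T ** e_col 1"
  defines "C \<equiv> controllability A v"
    and "P \<equiv> gramian A v"
    and "g \<equiv> g_col A v"
    and "R \<equiv> R_series A v"
    and "\<Theta> \<equiv> fps_of_poly p * R_series A v"
    and "c \<equiv> 1 - entry (adj v ** matrix_inv (mat 1 - adj A) ** g_col A v)"
  shows
    \<comment> \<open>the assertions accompanying the setup: the objects involved are well defined\<close>
    "(invertible C
      \<and> fps_of_poly p = fps_X ^ CARD('n)
          - entry ((\<chi> _ j. fps_X ^ (idx j - 1)) ** const_mat (matrix_inv C ** mat_power A CARD('n) ** v))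
      \<and> right_spectrum A \<subseteq> \<bbbB>\<^sub>1
      \<and> summable (gramian_term A v) \<and> invertible P \<and> invertible (mat 1 - A))
    \<comment> \<open>(1)\<close>
    \<and> (R = Abs_fps (\<lambda>k. entry (adj (e_col CARD('n)) ** matrix_inv C ** P ** mat_power (adj A) k ** g))
      \<and> (\<forall>\<gamma>\<in>\<bbbB>\<^sub>1. \<not> left_zero R \<gamma> \<and> \<not> right_zero R \<gamma>)
      \<and> R \<in> H2
      \<and> of_real ((H2_norm R)\<^sup>2)
          = entry (adj (e_col CARD('n)) ** matrix_inv C ** P ** adj (matrix_inv C) ** e_col CARD('n)))
    \<comment> \<open>(2)\<close>
    \<and> ((\<exists>d. blaschke_product d \<Theta>)
      \<and> \<Theta> = fps_const c + fps_X * entry (const_mat (adj v) ** resolvent (adj A) ** const_mat g)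
      \<and> \<Theta> = fps_const c + Abs_fps (\<lambda>m. case m of 0 \<Rightarrow> 0
            | Suc k \<Rightarrow> entry (adj v ** mat_power (adj A) k ** g)))"
proof -
  interpret companion_similar p A T v
  proof
    show "norm \<gamma> < 1" if "right_zero (fps_of_poly p) \<gamma>" for \<gamma>
      using zeros[of \<gamma>] that by simp
  qed (fact monic similar)+
  obtain \<beta>s s \<phi> where *: "set \<beta>s \<subseteq> \<bbbB>\<^sub>1" "s \<in> outer_poly" "norm \<phi> = 1"
    "s * R_series A v = fps_const \<phi>"
    "fps_of_poly p * R_series A v = prod_list (map blaschke_factor \<beta>s) * fps_const \<phi>"
    by (rule R_outer)
  have "\<phi> \<noteq> 0"
    using *(3) by auto
  then have zero_free: "\<forall>\<gamma>\<in>\<bbbB>\<^sub>1. \<not> left_zero (R_series A v) \<gamma> \<and> \<not> right_zero (R_series A v) \<gamma>"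
    using no_zeros_if_outer_mult_const[OF R_l1 *(2,4)] by blast
  have product: "\<exists>d. blaschke_product d (fps_of_poly p * R_series A v)"
    unfolding blaschke_product_def using *(1,3,5) by blast
  show ?thesis
    unfolding C_def P_def g_def R_def \<Theta>_def c_def
    by (intro conjI)
      (fact controllable fps_of_poly_eq spectrum_subset summable_gramian_term invertible_gramian
        invertible_1_minus R_series_eq zero_free l1_imp_H2[OF R_l1] R_norm product Theta_eq
        Theta_eq_Abs_fps)+
qed

end
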